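(* Let $Y$ be a compact smooth manifold or a finite simplicial complex, and let $\Gamma$ be a finitely generated group acting on $Y$ by Lipschitz homeomorphisms. If the action of $\Gamma$ on $Y$ is amenable, then the warped cone $\mathcal{O}_\Gamma(Y)$ has property A.
   Context: Open cone: embed $Y$ in a sphere $S^{N-1}\subset\mathbb{R}^N$ (smoothly if $Y$ is a manifold; if $Y$ is a finite complex, realize it as a subcomplex of a standard simplex and project radially to the sphere). The open cone is $\mathcal{O}Y=\{ty: t\ge 0,\ y\in Y\}\subset\mathbb{R}^N$ with the metric $d$ induced from $\mathbb{R}^N$. Up to coarse equivalence it does not depend on choices. $\Gamma$ acts on $\mathcal{O}Y$ by $\gamma(ty)=t(\gamma y)$. "Lipschitz homeomorphism" of $Y$ refers to a metric on $Y$ such as the one induced by the embedding. Warped metric: if $(X,d)$ is a proper metric space (closed bounded sets are compact) on which a group $\Gamma$ with finite generating set $S$ acts by homeomorphisms, then $d_\Gamma$ is the greatest metric on $X$ with $d_\Gamma(x,x')\le d(x,x')$ for all $x,x'\in X$ and $d_\Gamma(x,sx)\le 1$ for all $x\in X$, $s\in S$. The warped cone $\mathcal{O}_\Gamma(Y)$ is $\mathcal{O}Y$ with the metric $d_\Gamma$ (its coarse structure does not depend on choices; it is a proper metric space, of bounded geometry when the action is by Lipschitz homeomorphisms). Bounded geometry: a metric space $X$ has bounded geometry if there is $\epsilon>0$ such that for every $r>0$ there is $s>0$ such that every $\epsilon$-separated subset of an $r$-ball has at most $s$ elements. Property A: $\mathrm{Prob}(X)$ is the set of Radon probability measures on $X$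 (states of $C_0(X)$), with its norm and weak-$*$ topologies. A bounded geometry proper metric space $X$ has property A if there are weak-$*$ continuous maps $f_n\colon X\to\mathrm{Prob}(X)$ ($n=1,2,\dots$) such that (i) for each $n$ there is $r$ such that for each $x$ the measure $f_n(x)$ is supported in $B(x;r)$, and (ii) for each $s>0$, $\sup_{d(x,y)<s}\|f_n(x)-f_n(y)\|\to0$ as $n\to\infty$. Amenable action: an action of a discrete group $\Gamma$ on a compact Hausdorff space $Y$ is amenable if there are weak-$*$ continuous maps $\mu_n\colon Y\to\mathrm{Prob}(\Gamma)$ such that for each $\gamma\in\Gamma$, $\sup_{y\in Y}\|\gamma\cdot\mu_n(y)-\mu_n(\gamma y)\|\to0$ as $n\to\infty$, where $(\gamma\cdot\mu)\{\gamma'\}=\mu\{\gamma'\gamma\}$. (Via inversion on $\Gamma$ this is equivalent to the usual definition with $(\gamma\cdot\mu)\{\gamma'\}=\mu\{\gamma^{-1}\gamma'\}$.) *)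

theory Defs
  imports
    "HOL-Analysis.Analysis"
    "HOL-Probability.Probability_Measure"
    "HOL-Algebra.Generated_Groups"
    "HOL-Algebra.Group_Action"
begin

section \<open>The spaces: compact smooth manifolds and finite simplicial complexes in a sphere\<close>

text \<open>\<open>U\<close> is meant to be open. For open \<open>U\<close>, having continuous directional derivatives of all
  orders up to \<open>k\<close> is the usual meaning of \<open>C\<^sup>k\<close>.\<close>

primrec Ck_on :: "nat \<Rightarrow> 'a::euclidean_space set \<Rightarrow> ('a \<Rightarrow> 'b::euclidean_space) \<Rightarrow> bool" where
  "Ck_on 0 U f \<longleftrightarrow> continuous_on U f"
| "Ck_on (Suc k) U f \<longleftrightarrow>
     (\<forall>x\<in>U. f differentiable (at x)) \<and>
     (\<forall>v. Ck_on k U (\<lambda>x. frechet_derivative f (at x) v))"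

definition smooth_on :: "'a::euclidean_space set \<Rightarrow> ('a \<Rightarrow> 'b::euclidean_space) \<Rightarrow> bool" where
  "smooth_on U f \<longleftrightarrow> (\<forall>k. Ck_on k U f)"

text \<open>Smoothly embedded \<open>k\<close>-dimensional submanifolds (without boundary) of Euclidean space, by
  straightening charts of the ambient space: \<open>\<phi>\<close> is a diffeomorphism from \<open>U\<close> to \<open>V\<close> with inverse
  \<open>\<psi>\<close>, and it maps \<open>Y\<close> to a linear subspace \<open>L\<close>.\<close>

definition smooth_submanifold :: "nat \<Rightarrow> 'a::euclidean_space set \<Rightarrow> bool" where
  "smooth_submanifold k Y \<longleftrightarrow>
     (\<forall>p\<in>Y. \<exists>(U::'a set) (V::'a set) \<phi> \<psi> L.
        open U \<and> p \<in> U \<and> open V \<and>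
        homeomorphism U V \<phi> \<psi> \<and> smooth_on U \<phi> \<and> smooth_on V \<psi> \<and>
        subspace L \<and> dim L = k \<and> \<phi> ` (Y \<inter> U) = L \<inter> V)"

text \<open>A compact smooth manifold, smoothly embedded in the unit sphere.\<close>

definition spherical_compact_manifold :: "'a::euclidean_space set \<Rightarrow> bool" where
  "spherical_compact_manifold Y \<longleftrightarrow>
     compact Y \<and> Y \<subseteq> sphere 0 1 \<and> (\<exists>k. smooth_submanifold k Y)"

text \<open>A finite simplicial complex, realized as a subcomplex \<open>K\<close> of the standard simplex (the convex
  hull of the standard basis) and projected radially to the unit sphere. Finiteness of \<open>K\<close> is part
  of \<open>simplicial_complex\<close>.\<close>

definition spherical_finite_complex :: "'a::euclidean_space set \<Rightarrow> bool" where
  "spherical_finite_complex Y \<longleftrightarrow>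
     (\<exists>K. simplicial_complex K \<and> (\<forall>\<sigma>\<in>K. \<sigma> face_of (convex hull Basis)) \<and>
          Y = (\<lambda>x. x /\<^sub>R norm x) ` \<Union>K)"

definition lipschitz_homeomorphism_on :: "'a::metric_space set \<Rightarrow> ('a \<Rightarrow> 'a) \<Rightarrow> bool" where
  "lipschitz_homeomorphism_on Y f \<longleftrightarrow> (\<exists>g. homeomorphism Y Y f g) \<and> (\<exists>L. L-lipschitz_on Y f)"


section \<open>Warped cones\<close>

definition open_cone :: "'a::euclidean_space set \<Rightarrow> 'a set" where
  "open_cone Y = {t *\<^sub>R y | t y. 0 \<le> t \<and> y \<in> Y}"

text \<open>For \<open>Y\<close> in the unit sphere a point \<open>x = t *\<^sub>R y\<close> of the cone has \<open>t = norm x\<close> and, if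
  \<open>t > 0\<close>, \<open>y = x /\<^sub>R norm x\<close>; the apex is fixed.\<close>

definition cone_action :: "('g \<Rightarrow> 'a \<Rightarrow> 'a) \<Rightarrow> 'g \<Rightarrow> 'a::euclidean_space \<Rightarrow> 'a" where
  "cone_action a \<gamma> x = norm x *\<^sub>R a \<gamma> (x /\<^sub>R norm x)"

lemma cone_action_scaleR:
  assumes "norm y = 1" "0 \<le> t"
  shows "cone_action a \<gamma> (t *\<^sub>R y) = t *\<^sub>R a \<gamma> y"
  using assms by (cases "t = 0") (auto simp: cone_action_def)

definition warping_admissible ::
    "'a set \<Rightarrow> ('a \<Rightarrow> 'a \<Rightarrow> real) \<Rightarrow> 'g set \<Rightarrow> ('g \<Rightarrow> 'a \<Rightarrow> 'a) \<Rightarrow> ('a \<Rightarrow> 'a \<Rightarrow> real) \<Rightarrow> bool" where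
  "warping_admissible X d S a \<delta> \<longleftrightarrow>
     Metric_space X \<delta> \<and>
     (\<forall>x\<in>X. \<forall>x'\<in>X. \<delta> x x' \<le> d x x') \<and>
     (\<forall>x\<in>X. \<forall>s\<in>S. \<delta> x (a s x) \<le> 1)"

definition is_warped_metric ::
    "'a set \<Rightarrow> ('a \<Rightarrow> 'a \<Rightarrow> real) \<Rightarrow> 'g set \<Rightarrow> ('g \<Rightarrow> 'a \<Rightarrow> 'a) \<Rightarrow> ('a \<Rightarrow> 'a \<Rightarrow> real) \<Rightarrow> bool" where
  "is_warped_metric X d S a \<delta> \<longleftrightarrow>
     warping_admissible X d S a \<delta> \<and>
     (\<forall>\<delta>'. warping_admissible X d S a \<delta>' \<longrightarrow> (\<forall>x\<in>X. \<forall>x'\<in>X. \<delta>' x x' \<le> \<delta> x x'))"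

text \<open>A function satisfying \<open>is_warped_metric\<close> exists and is unique on \<open>X\<close>, as shown below; its
  values off \<open>X\<close> are irrelevant.\<close>

definition warped_metric ::
    "'a set \<Rightarrow> ('a \<Rightarrow> 'a \<Rightarrow> real) \<Rightarrow> 'g set \<Rightarrow> ('g \<Rightarrow> 'a \<Rightarrow> 'a) \<Rightarrow> 'a \<Rightarrow> 'a \<Rightarrow> real" where
  "warped_metric X d S a = (SOME \<delta>. is_warped_metric X d S a \<delta>)"

lemma is_warped_metric_unique:
  assumes "is_warped_metric X d S a \<delta>" "is_warped_metric X d S a \<delta>'" "x \<in> X" "x' \<in> X"
  shows "\<delta> x x' = \<delta>' x x'"
  using assms unfolding is_warped_metric_def by (meson order_antisym)

lemma is_warped_metric_exists:
  assumes d: "Metric_space X d" and a: "\<And>s x. s \<in> S \<Longrightarrow> x \<in> X \<Longrightarrow> a s x \<in> X"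
  shows "\<exists>\<delta>. is_warped_metric X d S a \<delta>"
proof -
  interpret d: Metric_space X d by (fact d)
  define A where "A = Collect (warping_admissible X d S a)"
  define \<delta> where "\<delta> x y = (if x \<in> X \<and> y \<in> X then SUP \<delta>\<in>A. \<delta> x y else 0)" for x y
  have "Metric_space X (\<lambda>x y. min (d x y) 1)"
  proof
    show "min (d x z) 1 \<le> min (d x y) 1 + min (d y z) 1"
      if "x \<in> X" "y \<in> X" "z \<in> X" for x y z
      using d.triangle[OF that] d.nonneg[of x y] d.nonneg[of y z] by linarith
  qed (auto simp: d.commute min_def)
  then have base: "(\<lambda>x y. min (d x y) 1) \<in> A"
    by (auto simp: A_def warping_admissible_def)
  have bdd: "bdd_above ((\<lambda>\<delta>. \<delta> x y) ` A)" if "x \<in> X" "y \<in> X" for x y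
    by (rule bdd_aboveI[of _ "d x y"]) (use that in \<open>auto simp: A_def warping_admissible_def\<close>)
  have upper: "\<eta> x y \<le> \<delta> x y" if "\<eta> \<in> A" "x \<in> X" "y \<in> X" for \<eta> x y
    unfolding \<delta>_def using that by (auto intro: cSUP_upper[OF _ bdd])
  have least: "\<delta> x y \<le> c" if "x \<in> X" "y \<in> X" "\<And>\<eta>. \<eta> \<in> A \<Longrightarrow> \<eta> x y \<le> c" for x y c
    unfolding \<delta>_def using that base by (auto intro!: cSUP_least)
  have met: "Metric_space X \<eta>" if "\<eta> \<in> A" for \<eta>
    using that by (simp add: A_def warping_admissible_def)
  have "Metric_space X \<delta>"
  proof
    show nn: "0 \<le> \<delta> x y" for x y
    proof (cases "x \<in> X \<and> y \<in> X")
      case True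
      then show ?thesis using upper[OF base, of x y] d.nonneg[of x y] by linarith
    qed (auto simp: \<delta>_def)
    show "\<delta> x y = \<delta> y x" for x y
    proof -
      have "(SUP \<eta>\<in>A. \<eta> x y) = (SUP \<eta>\<in>A. \<eta> y x)"
        by (rule SUP_cong) (auto dest: met simp: Metric_space.commute)
      then show ?thesis by (auto simp: \<delta>_def)
    qed
    show "\<delta> x y = 0 \<longleftrightarrow> x = y" if "x \<in> X" "y \<in> X" for x y
    proof
      assume "\<delta> x y = 0"
      then have "min (d x y) 1 \<le> 0" using upper[OF base that] by simp
      then have "d x y \<le> 0" by (simp add: min_le_iff_disj)
      then have "d x y = 0" using d.nonneg[of x y] by linarith
      then show "x = y" using that by simp
    next
      assume "x = y"
      then have "\<eta> x y \<le> 0" if "\<eta> \<in> A" for \<eta>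
        using Metric_space.zero[OF met[OF that]] \<open>x \<in> X\<close> \<open>y \<in> X\<close> by (metis order_refl)
      then have "\<delta> x y \<le> 0" by (rule least[OF that])
      then show "\<delta> x y = 0" using nn[of x y] by linarith
    qed
    show "\<delta> x z \<le> \<delta> x y + \<delta> y z" if "x \<in> X" "y \<in> X" "z \<in> X" for x y z
    proof (rule least)
      fix \<eta> assume \<eta>: "\<eta> \<in> A"
      show "\<eta> x z \<le> \<delta> x y + \<delta> y z"
        using Metric_space.triangle[OF met[OF \<eta>] that] upper[OF \<eta>, of x y] upper[OF \<eta>, of y z] that
        by linarith
    qed (use that in auto)
  qed
  moreover have "\<delta> x y \<le> d x y" if "x \<in> X" "y \<in> X" for x y
    using that by (intro least) (auto simp: A_def warping_admissible_def)
  moreover have "\<delta> x (a s x) \<le> 1" if "x \<in> X" "s \<in> S" for x s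
    using that a by (intro least) (auto simp: A_def warping_admissible_def)
  ultimately have "is_warped_metric X d S a \<delta>"
    using upper by (auto simp: is_warped_metric_def warping_admissible_def A_def)
  then show ?thesis by blast
qed


section \<open>Probability measures\<close>

definition C0 :: "'a topology \<Rightarrow> ('a \<Rightarrow> real) set" where
  "C0 T = {u. continuous_map T euclideanreal u \<and>
              (\<forall>\<epsilon>>0. \<exists>K. compactin T K \<and> (\<forall>x \<in> topspace T - K. \<bar>u x\<bar> < \<epsilon>))}"

text \<open>Radon probability measures: Borel probability measures that are inner regular with respect to
  compact sets.\<close>

definition Prob :: "'a topology \<Rightarrow> 'a measure set" where
  "Prob T = {\<mu>. space \<mu> = topspace T \<and>
                sets \<mu> = sigma_sets (topspace T) {U. openin T U} \<and>
                prob_space \<mu> \<and>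
                (\<forall>B \<in> sets \<mu>. emeasure \<mu> B = (SUP K\<in>{K. compactin T K \<and> K \<subseteq> B}. emeasure \<mu> K))}"

text \<open>The norm distance of two measures, as functionals on \<open>C0 T\<close>.\<close>

definition Prob_dist :: "'a topology \<Rightarrow> 'a measure \<Rightarrow> 'a measure \<Rightarrow> real" where
  "Prob_dist T \<mu> \<nu> =
     (SUP u\<in>{u \<in> C0 T. \<forall>x\<in>topspace T. \<bar>u x\<bar> \<le> 1}. \<bar>(\<integral>x. u x \<partial>\<mu>) - (\<integral>x. u x \<partial>\<nu>)\<bar>)"

definition weak_star_continuous :: "'a topology \<Rightarrow> 'b topology \<Rightarrow> ('a \<Rightarrow> 'b measure) \<Rightarrow> bool" where
  "weak_star_continuous T T' f \<longleftrightarrow>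
     (\<forall>x\<in>topspace T. f x \<in> Prob T') \<and>
     (\<forall>u\<in>C0 T'. continuous_map T euclideanreal (\<lambda>x. \<integral>z. u z \<partial>f x))"


section \<open>Property A\<close>

definition proper_metric :: "'a set \<Rightarrow> ('a \<Rightarrow> 'a \<Rightarrow> real) \<Rightarrow> bool" where
  "proper_metric X d \<longleftrightarrow>
     Metric_space X d \<and>
     (\<forall>C. closedin (Metric_space.mtopology X d) C \<and> Metric_space.mbounded X d C \<longrightarrow>
          compactin (Metric_space.mtopology X d) C)"

definition bounded_geometry :: "'a set \<Rightarrow> ('a \<Rightarrow> 'a \<Rightarrow> real) \<Rightarrow> bool" where
  "bounded_geometry X d \<longleftrightarrow>
     (\<exists>\<epsilon>>0. \<forall>r>0. \<exists>s>0. \<forall>x\<in>X. \<forall>A \<subseteq> Metric_space.mball X d x r.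
        (\<forall>p\<in>A. \<forall>q\<in>A. p \<noteq> q \<longrightarrow> \<epsilon> \<le> d p q) \<longrightarrow> finite A \<and> real (card A) \<le> s)"

text \<open>Property A is a notion for proper metric spaces of bounded geometry, so these two conditions
  are part of the definition. Here and below, \<open>uniform_limit Z h (\<lambda>_. 0) sequentially\<close> for
  nonnegative \<open>h n\<close> expresses that the supremum of \<open>h n\<close> over \<open>Z\<close> tends to 0 (also for empty
  \<open>Z\<close>).\<close>

definition property_A :: "'a set \<Rightarrow> ('a \<Rightarrow> 'a \<Rightarrow> real) \<Rightarrow> bool" where
  "property_A X d \<longleftrightarrow>
     proper_metric X d \<and> bounded_geometry X d \<and>
     (let T = Metric_space.mtopology X d in
      \<exists>f :: nat \<Rightarrow> 'a \<Rightarrow> 'a measure.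
        (\<forall>n. weak_star_continuous T T (f n)) \<and>
        (\<forall>n. \<exists>r. \<forall>x\<in>X. measure (f n x) (Metric_space.mball X d x r) = 1) \<and>
        (\<forall>s>0. uniform_limit {(x, y). x \<in> X \<and> y \<in> X \<and> d x y < s}
                 (\<lambda>n (x, y). Prob_dist T (f n x) (f n y)) (\<lambda>_. 0) sequentially))"


section \<open>Amenable actions\<close>

text \<open>\<open>(\<gamma> \<cdot> \<mu>){\<gamma>'} = \<mu>{\<gamma>' \<gamma>}\<close>, i.e. the push-forward along right multiplication by \<open>\<gamma>\<inverse>\<close>.\<close>

definition translate :: "('g, 'm) monoid_scheme \<Rightarrow> 'g \<Rightarrow> 'g measure \<Rightarrow> 'g measure" where
  "translate G \<gamma> \<mu> = distr \<mu> \<mu> (\<lambda>g. g \<otimes>\<^bsub>G\<^esub> inv\<^bsub>G\<^esub> \<gamma>)"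

lemma measure_translate_singleton:
  assumes "group G" "\<mu> \<in> Prob (discrete_topology (carrier G))" "\<gamma> \<in> carrier G" "\<gamma>' \<in> carrier G"
  shows "measure (translate G \<gamma> \<mu>) {\<gamma>'} = measure \<mu> {\<gamma>' \<otimes>\<^bsub>G\<^esub> \<gamma>}"
proof -
  interpret group G by (fact assms(1))
  have sp: "space \<mu> = carrier G" using assms(2) by (simp add: Prob_def)
  have "sets \<mu> = sigma_sets (carrier G) (Pow (carrier G))"
    using assms(2) by (simp add: Prob_def Pow_def)
  then have st: "sets \<mu> = Pow (carrier G)"
    by (metis sigma_algebra.sigma_sets_eq sigma_algebra_Pow)
  have "(\<lambda>g. g \<otimes>\<^bsub>G\<^esub> inv\<^bsub>G\<^esub> \<gamma>) \<in> measurable \<mu> \<mu>"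
    using assms(3) by (auto simp: measurable_def sp st)
  moreover have "(\<lambda>g. g \<otimes>\<^bsub>G\<^esub> inv\<^bsub>G\<^esub> \<gamma>) -` {\<gamma>'} \<inter> space \<mu> = {\<gamma>' \<otimes>\<^bsub>G\<^esub> \<gamma>}"
    using assms(3,4) by (auto simp: sp m_assoc)
  ultimately show ?thesis
    using assms(4) by (simp add: translate_def measure_distr st)
qed

text \<open>\<open>Y\<close> is the (compact Hausdorff) space acted on, and \<open>G\<close> is discrete.\<close>

definition amenable_action ::
    "('g, 'm) monoid_scheme \<Rightarrow> 'a topology \<Rightarrow> ('g \<Rightarrow> 'a \<Rightarrow> 'a) \<Rightarrow> bool" where
  "amenable_action G Y a \<longleftrightarrow>
     (let D = discrete_topology (carrier G) in
      \<exists>\<mu> :: nat \<Rightarrow> 'a \<Rightarrow> 'g measure.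
        (\<forall>n. weak_star_continuous Y D (\<mu> n)) \<and>
        (\<forall>\<gamma>\<in>carrier G. uniform_limit (topspace Y)
            (\<lambda>n y. Prob_dist D (translate G \<gamma> (\<mu> n y)) (\<mu> n (a \<gamma> y))) (\<lambda>_. 0) sequentially))"

end

theory Submission
  imports Defs
begin

text \<open>
  Three quantities are patched together. Amenability gives kernels \<open>p\<close> from \<open>Y\<close> to probability
  vectors on \<open>\<Gamma>\<close> with common finite support and \<open>p y (g \<gamma>) \<approx> p (\<gamma> y) g\<close>; averaging over Euclidean
  balls of a large radius \<open>M\<close> gives slowly varying weights \<open>bump M\<close> on \<open>\<real>\<^sup>N\<close>. On the cone the weights
  \<open>P x = (\<Sum>g. p (x / |x|) g * bump M (g x))\<close> are then almost invariant under \<open>\<Gamma>\<close>, and, since the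
  finitely many \<open>g\<close> that occur are Lipschitz, they vary slowly in the Euclidean metric as long as
  \<open>|x|\<close> is large. Near the apex \<open>P\<close> is cut off against the constant weights \<open>bump M 0\<close> by a slowly
  varying function of \<open>|x|\<close>, which is invariant under \<open>\<Gamma>\<close>. This suffices because points at bounded
  warped distance are related by a bounded Euclidean move and one of finitely many group elements.
\<close>

section \<open>Finitely supported measures\<close>

text \<open>The weights live on lattice points of the ambient space because there the growth of
  balls supplies a slowly varying partition of unity. Lattice points usually lie off the cone, so
  each label \<open>k\<close> is finally replaced by a cone point \<open>z k\<close> chosen once for
  all \<open>x\<close>; with a choice depending on \<open>x\<close>, the l1 distance of weights
  would say nothing about the measures.

  The shape near the apex is forced by the kernel: it is uniformly continuous in the direction, but
  no modulus is at hand. A Euclidean move by \<open>R\<close> turns the direction by at most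
  \<open>2 * R / |x|\<close>, which is small only for large \<open>|x|\<close>, and the direction
  has no limit at the apex.

  The order of choices matters. The distance \<open>r\<close> fixes the group elements and the
  Euclidean move \<open>R\<close>. The kernel comes next, since the Lipschitz constant of its finite
  support enters the ball radius \<open>M\<close>, and its modulus of continuity decides where the
  cut-off starts. The supports stay bounded because each of the finitely many \<open>g\<close> moves
  points by a bounded warped distance, although the Euclidean displacement can grow with
  \<open>|x|\<close>.\<close>

definition dirac_sum :: "'a topology \<Rightarrow> 'k set \<Rightarrow> ('k \<Rightarrow> real) \<Rightarrow> ('k \<Rightarrow> 'a) \<Rightarrow> 'a measure" where
  "dirac_sum T A w z =
     distr (point_measure A (\<lambda>k. ennreal (w k))) (sigma (topspace T) {U. openin T U}) z"

lemma sets_sigma_topology [simp]: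
  "sets (sigma (topspace T) {U. openin T U}) = sigma_sets (topspace T) {U. openin T U}"
  "space (sigma (topspace T) {U. openin T U}) = topspace T"
  using openin_subset[of T] by (simp_all add: subset_Pow_Union sets_measure_of space_measure_of subset_iff Pow_def Collect_mono)

lemma space_sets_dirac_sum [simp]:
  "space (dirac_sum T A w z) = topspace T"
  "sets (dirac_sum T A w z) = sigma_sets (topspace T) {U. openin T U}"
  by (simp_all add: dirac_sum_def)

lemma measurable_dirac:
  "z ` A \<subseteq> topspace T \<Longrightarrow>
    z \<in> measurable (point_measure A f) (sigma (topspace T) {U. openin T U})"
  by (simp add: image_subset_iff_funcset)

lemma emeasure_dirac_sum:
  assumes "finite A" "z ` A \<subseteq> topspace T" "\<And>k. k \<in> A \<Longrightarrow> 0 \<le> w k"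
    and "B \<in> sigma_sets (topspace T) {U. openin T U}"
  shows "emeasure (dirac_sum T A w z) B = ennreal (\<Sum>k\<in>{k\<in>A. z k \<in> B}. w k)"
proof -
  have "emeasure (dirac_sum T A w z) B =
      emeasure (point_measure A (\<lambda>k. ennreal (w k))) (z -` B \<inter> A)"
    unfolding dirac_sum_def
    by (subst emeasure_distr[OF measurable_dirac]) (use assms in \<open>auto simp: space_point_measure\<close>)
  also have "z -` B \<inter> A = {k\<in>A. z k \<in> B}" by blast
  also have "emeasure (point_measure A (\<lambda>k. ennreal (w k))) {k\<in>A. z k \<in> B} =
      (\<Sum>k\<in>{k\<in>A. z k \<in> B}. ennreal (w k))"
    using assms(1) by (intro emeasure_point_measure_finite) auto
  also have "\<dots> = ennreal (\<Sum>k\<in>{k\<in>A. z k \<in> B}. w k)"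
    using assms by (intro sum_ennreal) auto
  finally show ?thesis .
qed

lemma integral_dirac_sum:
  assumes "finite A" "z ` A \<subseteq> topspace T" "\<And>k. k \<in> A \<Longrightarrow> 0 \<le> w k"
    and "continuous_map T euclideanreal u"
  shows "(\<integral>x. u x \<partial>dirac_sum T A w z) = (\<Sum>k\<in>A. w k * u (z k))"
proof -
  have "u \<in> borel_measurable (sigma (topspace T) {U. openin T U})"
  proof (rule borel_measurableI)
    fix V :: "real set" assume "open V"
    then have "openin T {x \<in> topspace T. u x \<in> V}"
      using assms(4) by (simp add: continuous_map_def)
    moreover have "u -` V \<inter> topspace T = {x \<in> topspace T. u x \<in> V}" by blast
    ultimately show "u -` V \<inter> space (sigma (topspace T) {U. openin T U})
        \<in> sets (sigma (topspace T) {U. openin T U})"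
      by (auto intro: sigma_sets.Basic)
  qed
  then have "(\<integral>x. u x \<partial>dirac_sum T A w z) =
      (\<integral>k. u (z k) \<partial>point_measure A (\<lambda>k. ennreal (w k)))"
    unfolding dirac_sum_def by (rule integral_distr[OF measurable_dirac[OF assms(2)]])
  also have "\<dots> = (\<Sum>k\<in>A. w k * u (z k))"
    using assms by (subst lebesgue_integral_point_measure_finite) auto
  finally show ?thesis .
qed

text \<open>The atoms lying in \<open>B\<close> form a finite, hence compact, subset of
  \<open>B\<close> of the same mass, which gives inner regularity. \<open>T\<close> being T1 makes
  this set closed and so measurable.\<close>

lemma dirac_sum_in_Prob:
  assumes A: "finite A" "z ` A \<subseteq> topspace T" "\<And>k. k \<in> A \<Longrightarrow> 0 \<le> w k" "(\<Sum>k\<in>A. w k) = 1"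
    and T: "t1_space T"
  shows "dirac_sum T A w z \<in> Prob T"
  unfolding Prob_def
proof (intro CollectI conjI ballI)
  let ?\<mu> = "dirac_sum T A w z"
  note em = emeasure_dirac_sum[OF A(1-3)]
  have closed: "B \<in> sigma_sets (topspace T) {U. openin T U}" if "closedin T B" for B
  proof -
    have "topspace T - (topspace T - B) \<in> sigma_sets (topspace T) {U. openin T U}"
      using that by (intro sigma_sets.Compl sigma_sets.Basic) (auto simp: closedin_def)
    then show ?thesis using closedin_subset[OF that] by (simp add: double_diff)
  qed
  have "{k \<in> A. z k \<in> topspace T} = A" using A(2) by auto
  then have "emeasure ?\<mu> (topspace T) = 1"
    using em[where B="topspace T"] closed[of "topspace T"] A(4) by simp
  then show "prob_space ?\<mu>" by (intro prob_spaceI) simp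
  fix B assume B: "B \<in> sets ?\<mu>"
  show "emeasure ?\<mu> B = (SUP K\<in>{K. compactin T K \<and> K \<subseteq> B}. emeasure ?\<mu> K)"
  proof (rule antisym)
    let ?K = "z ` {k \<in> A. z k \<in> B}"
    have K: "finite ?K" "?K \<subseteq> topspace T" "?K \<subseteq> B" using A by auto
    have "{k \<in> A. z k \<in> ?K} = {k \<in> A. z k \<in> B}" by auto
    moreover have "closedin T ?K" using K T by (simp add: t1_space_closedin_finite)
    ultimately have "emeasure ?\<mu> B = emeasure ?\<mu> ?K"
      using em[where B=B] em[where B="?K"] closed B by simp
    also have "\<dots> \<le> (SUP K\<in>{K. compactin T K \<and> K \<subseteq> B}. emeasure ?\<mu> K)"
      using K by (intro SUP_upper) (auto intro: finite_imp_compactin)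
    finally show "emeasure ?\<mu> B \<le> (SUP K\<in>{K. compactin T K \<and> K \<subseteq> B}. emeasure ?\<mu> K)" .
    show "(SUP K\<in>{K. compactin T K \<and> K \<subseteq> B}. emeasure ?\<mu> K) \<le> emeasure ?\<mu> B"
      using B by (intro SUP_least emeasure_mono) auto
  qed
qed auto

lemma measure_dirac_sum_eq_1:
  assumes A: "finite A" "z ` A \<subseteq> topspace T" "\<And>k. k \<in> A \<Longrightarrow> 0 \<le> w k" "(\<Sum>k\<in>A. w k) = 1"
    and B: "openin T B" "\<And>k. k \<in> A \<Longrightarrow> w k \<noteq> 0 \<Longrightarrow> z k \<in> B"
  shows "measure (dirac_sum T A w z) B = 1"
proof -
  have "(\<Sum>k\<in>{k\<in>A. z k \<in> B}. w k) = (\<Sum>k\<in>A. w k)"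
    using A B by (intro sum.mono_neutral_left) auto
  then show ?thesis
    using emeasure_dirac_sum[OF A(1-3), where B=B] A(4) B(1) by (simp add: measure_def sigma_sets.Basic)
qed

text \<open>A test function is bounded by 1 at every \<open>z k\<close>, so the integrals differ by
  at most the l1 distance of the weights. Labels with the same point \<open>z k\<close> can only
  merge mass, so \<open>z\<close> may fail to be injective.\<close>

lemma Prob_dist_dirac_sum_le:
  assumes "finite A" "z ` A \<subseteq> topspace T" "\<And>k. k \<in> A \<Longrightarrow> 0 \<le> w k" "\<And>k. k \<in> A \<Longrightarrow> 0 \<le> w' k"
  shows "Prob_dist T (dirac_sum T A w z) (dirac_sum T A w' z) \<le> (\<Sum>k\<in>A. \<bar>w k - w' k\<bar>)"
  unfolding Prob_dist_def
proof (rule cSUP_least)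
  have "(\<lambda>_. 0) \<in> C0 T" by (auto simp: C0_def intro: exI[of _ "{}"])
  then show "{u \<in> C0 T. \<forall>x\<in>topspace T. \<bar>u x\<bar> \<le> 1} \<noteq> {}" by fastforce
next
  fix u assume u: "u \<in> {u \<in> C0 T. \<forall>x\<in>topspace T. \<bar>u x\<bar> \<le> 1}"
  then have c: "continuous_map T euclideanreal u" by (simp add: C0_def)
  have "\<bar>(\<integral>x. u x \<partial>dirac_sum T A w z) - (\<integral>x. u x \<partial>dirac_sum T A w' z)\<bar>
      = \<bar>\<Sum>k\<in>A. (w k - w' k) * u (z k)\<bar>"
    using assms by (simp add: integral_dirac_sum[OF _ _ _ c] algebra_simps sum_subtractf)
  also have "\<dots> \<le> (\<Sum>k\<in>A. \<bar>(w k - w' k) * u (z k)\<bar>)" by (rule sum_abs)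
  also have "\<dots> \<le> (\<Sum>k\<in>A. \<bar>w k - w' k\<bar>)"
    using u assms(2) by (intro sum_mono) (auto simp: abs_mult image_subset_iff intro!: mult_left_le)
  finally show "\<bar>(\<integral>x. u x \<partial>dirac_sum T A w z) - (\<integral>x. u x \<partial>dirac_sum T A w' z)\<bar>
      \<le> (\<Sum>k\<in>A. \<bar>w k - w' k\<bar>)" .
qed

text \<open>The integral of a non-integrable function is 0 by convention, so no measurability of
  \<open>u\<close> has to be established.\<close>

lemma abs_integral_le_1:
  assumes "prob_space \<mu>" "\<And>x. x \<in> space \<mu> \<Longrightarrow> \<bar>u x\<bar> \<le> (1::real)"
  shows "\<bar>\<integral>x. u x \<partial>\<mu>\<bar> \<le> 1"
proof (cases "integrable \<mu> u")
  case True
  interpret prob_space \<mu> by fact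
  have "\<bar>\<integral>x. u x \<partial>\<mu>\<bar> \<le> (\<integral>x. \<bar>u x\<bar> \<partial>\<mu>)" by (rule integral_abs_bound)
  also have "\<dots> \<le> (\<integral>x. 1 \<partial>\<mu>)" using True assms by (intro integral_mono) auto
  finally show ?thesis by (simp add: prob_space)
qed (simp add: not_integrable_integral_eq)

text \<open>The supremum in \<open>Prob_dist\<close> is a real one and bounds its members only once
  boundedness is known; total mass 1 gives the bound 2.\<close>

lemma Prob_dist_bdd:
  assumes "prob_space \<mu>" "space \<mu> = topspace T" "prob_space \<nu>" "space \<nu> = topspace T"
  shows "bdd_above ((\<lambda>u. \<bar>(\<integral>x. u x \<partial>\<mu>) - (\<integral>x. u x \<partial>\<nu>)\<bar>) ` {u \<in> C0 T. \<forall>x\<in>topspace T. \<bar>u x\<bar> \<le> 1})"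
proof (rule bdd_aboveI2)
  fix u assume "u \<in> {u \<in> C0 T. \<forall>x\<in>topspace T. \<bar>u x\<bar> \<le> 1}"
  then have "\<bar>\<integral>x. u x \<partial>\<mu>\<bar> \<le> 1" "\<bar>\<integral>x. u x \<partial>\<nu>\<bar> \<le> 1"
    using assms by (auto intro!: abs_integral_le_1)
  then show "\<bar>(\<integral>x. u x \<partial>\<mu>) - (\<integral>x. u x \<partial>\<nu>)\<bar> \<le> 2" by linarith
qed

lemma Prob_dist_upper:
  assumes "prob_space \<mu>" "space \<mu> = topspace T" "prob_space \<nu>" "space \<nu> = topspace T"
    and "u \<in> C0 T" "\<And>x. x \<in> topspace T \<Longrightarrow> \<bar>u x\<bar> \<le> 1"
  shows "\<bar>(\<integral>x. u x \<partial>\<mu>) - (\<integral>x. u x \<partial>\<nu>)\<bar> \<le> Prob_dist T \<mu> \<nu>"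
  unfolding Prob_dist_def using assms by (intro cSUP_upper Prob_dist_bdd) auto

lemma Prob_dist_nonneg:
  assumes "prob_space \<mu>" "space \<mu> = topspace T" "prob_space \<nu>" "space \<nu> = topspace T"
  shows "0 \<le> Prob_dist T \<mu> \<nu>"
proof -
  have "(\<lambda>_. 0) \<in> C0 T" by (auto simp: C0_def intro: exI[of _ "{}"])
  from Prob_dist_upper[OF assms this] show ?thesis by simp
qed

lemma ProbD:
  assumes "\<mu> \<in> Prob T"
  shows "prob_space \<mu>" "space \<mu> = topspace T" "sets \<mu> = sigma_sets (topspace T) {U. openin T U}"
  using assms by (simp_all add: Prob_def)

text \<open>Near each point all label sets sit in one finite \<open>B\<close>, and the weights
  vanish on the labels that are added. There the integral of a test function is a fixed finite sum
  of continuous functions, although \<open>A x\<close> itself may jump.\<close>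

lemma weak_star_continuous_dirac_sum:
  assumes T: "t1_space T"
    and A: "\<And>x. x \<in> topspace T \<Longrightarrow> finite (A x)"
    and w: "\<And>x k. x \<in> topspace T \<Longrightarrow> 0 \<le> w x k"
    and w1: "\<And>x. x \<in> topspace T \<Longrightarrow> (\<Sum>k\<in>A x. w x k) = 1"
    and z: "\<And>x. x \<in> topspace T \<Longrightarrow> z ` A x \<subseteq> topspace T'"
    and T': "t1_space T'"
    and cont: "\<And>k. continuous_map T euclideanreal (\<lambda>x. w x k)"
    and loc: "\<And>x. x \<in> topspace T \<Longrightarrow>
      \<exists>U B. openin T U \<and> x \<in> U \<and> finite B \<and> (\<forall>x'\<in>U. A x' \<subseteq> B \<and> (\<forall>k\<in>B - A x'. w x' k = 0))"
  shows "weak_star_continuous T T' (\<lambda>x. dirac_sum T' (A x) (w x) z)"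
  unfolding weak_star_continuous_def
proof (intro conjI ballI)
  fix x assume "x \<in> topspace T"
  then show "dirac_sum T' (A x) (w x) z \<in> Prob T'"
    using assms by (intro dirac_sum_in_Prob) auto
next
  fix u assume u: "u \<in> C0 T'"
  then have cu: "continuous_map T' euclideanreal u" by (simp add: C0_def)
  have eq: "(\<integral>y. u y \<partial>dirac_sum T' (A x) (w x) z) = (\<Sum>k\<in>A x. w x k * u (z k))"
    if "x \<in> topspace T" for x
    using that assms by (intro integral_dirac_sum[OF _ _ _ cu]) auto
  show "continuous_map T euclideanreal (\<lambda>x. \<integral>y. u y \<partial>dirac_sum T' (A x) (w x) z)"
    unfolding continuous_map_atin limitin_canonical_iff
  proof
    fix x assume x: "x \<in> topspace T"
    obtain U B where U: "openin T U" "x \<in> U" "finite B"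
      and B: "\<And>x'. x' \<in> U \<Longrightarrow> A x' \<subseteq> B \<and> (\<forall>k\<in>B - A x'. w x' k = 0)"
      using loc[OF x] by blast
    have eqB: "(\<integral>y. u y \<partial>dirac_sum T' (A x') (w x') z) = (\<Sum>k\<in>B. w x' k * u (z k))"
      if "x' \<in> U" for x'
    proof -
      have "x' \<in> topspace T" using that U openin_subset by blast
      then show ?thesis unfolding eq[OF \<open>x' \<in> topspace T\<close>] using B[OF that] U
        by (intro sum.mono_neutral_left) auto
    qed
    have "((\<lambda>x'. \<Sum>k\<in>B. w x' k * u (z k)) \<longlongrightarrow> (\<Sum>k\<in>B. w x k * u (z k))) (atin T x)"
      using cont x by (intro tendsto_sum tendsto_mult tendsto_const) (simp add: continuous_map_atin)
    moreover have "\<forall>\<^sub>F x' in atin T x. (\<Sum>k\<in>B. w x' k * u (z k)) = (\<integral>y. u y \<partial>dirac_sum T' (A x') (w x') z)"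
      using U eqB by (auto simp: eventually_atin x)
    ultimately show "((\<lambda>x. \<integral>y. u y \<partial>dirac_sum T' (A x) (w x) z) \<longlongrightarrow>
        (\<integral>y. u y \<partial>dirac_sum T' (A x) (w x) z)) (atin T x)"
      using eqB[OF U(2)] by (simp add: tendsto_cong)
  qed
qed


section \<open>Amenable actions and finitely supported kernels\<close>

lemma Prob_discrete_sets:
  assumes "\<mu> \<in> Prob (discrete_topology C)"
  shows "sets \<mu> = Pow C"
proof -
  have "sets \<mu> = sigma_sets C (Pow C)" using ProbD(3)[OF assms] by (simp add: Pow_def)
  then show ?thesis by (metis sigma_algebra.sigma_sets_eq sigma_algebra_Pow)
qed

lemma Prob_discrete_sum:
  assumes "\<mu> \<in> Prob (discrete_topology C)" "finite H" "H \<subseteq> C"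
  shows "(\<Sum>h\<in>H. measure \<mu> {h}) = measure \<mu> H" "(\<Sum>h\<in>H. measure \<mu> {h}) \<le> 1"
proof -
  interpret prob_space \<mu> using ProbD[OF assms(1)] by simp
  show "(\<Sum>h\<in>H. measure \<mu> {h}) = measure \<mu> H"
    using assms Prob_discrete_sets[OF assms(1)]
    by (intro finite_measure_eq_sum_singleton[symmetric]) auto
  then show "(\<Sum>h\<in>H. measure \<mu> {h}) \<le> 1" by simp
qed

text \<open>Inner regularity at the whole space is tightness here, since compact sets of a discrete
  space are finite.\<close>

lemma Prob_discrete_tight:
  assumes "\<mu> \<in> Prob (discrete_topology C)" "c < 1"
  shows "\<exists>H. finite H \<and> H \<subseteq> C \<and> c < (\<Sum>h\<in>H. measure \<mu> {h})"
proof -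
  interpret prob_space \<mu> using ProbD[OF assms(1)] by simp
  have sp: "space \<mu> = C" using ProbD[OF assms(1)] by simp
  have "(SUP K\<in>{K. compactin (discrete_topology C) K \<and> K \<subseteq> C}. emeasure \<mu> K) = emeasure \<mu> C"
    using assms(1) Prob_discrete_sets[OF assms(1)] unfolding Prob_def by auto
  also have "\<dots> = 1" using emeasure_space_1 sp by simp
  finally have "ennreal (max c 0) < (SUP K\<in>{K. compactin (discrete_topology C) K \<and> K \<subseteq> C}. emeasure \<mu> K)"
    using assms(2) by (simp add: ennreal_less_one_iff)
  then obtain H where H: "compactin (discrete_topology C) H" "ennreal (max c 0) < emeasure \<mu> H"
    by (auto simp: less_SUP_iff)
  then have "finite H" "H \<subseteq> C" by (auto simp: compactin_discrete_topology)
  moreover have "c < measure \<mu> H"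
    using H(2) by (simp add: emeasure_eq_measure ennreal_less_iff)
  ultimately show ?thesis using Prob_discrete_sum(1)[OF assms(1)] by auto
qed

lemma C0_discrete_finite_support:
  assumes "finite H" "\<And>x. x \<in> C \<Longrightarrow> x \<notin> H \<Longrightarrow> u x = 0"
  shows "u \<in> C0 (discrete_topology C)"
  unfolding C0_def
proof (intro CollectI conjI allI impI)
  show "\<exists>K. compactin (discrete_topology C) K \<and> (\<forall>x\<in>topspace (discrete_topology C) - K. \<bar>u x\<bar> < \<epsilon>)"
    if "\<epsilon> > 0" for \<epsilon>
  proof (intro exI[of _ "H \<inter> C"] conjI ballI)
    fix x assume "x \<in> topspace (discrete_topology C) - H \<inter> C"
    then have "u x = 0" using assms(2) by auto
    then show "\<bar>u x\<bar> < \<epsilon>" using that by simp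
  qed (use assms(1) in \<open>simp add: compactin_discrete_topology\<close>)
qed simp

text \<open>The sign of the difference, cut off to \<open>H\<close>, is a test function that
  recovers the l1 distance over \<open>H\<close>. The premises ask for less than membership in
  \<open>Prob\<close> because the translated measure is used without proving it Radon.\<close>

lemma sum_le_Prob_dist_discrete:
  assumes \<mu>: "prob_space \<mu>" "sets \<mu> = Pow C" and \<nu>: "prob_space \<nu>" "sets \<nu> = Pow C"
    and H: "finite H" "H \<subseteq> C"
  shows "(\<Sum>h\<in>H. \<bar>measure \<mu> {h} - measure \<nu> {h}\<bar>) \<le> Prob_dist (discrete_topology C) \<mu> \<nu>"
proof -
  define s where "s h = (if measure \<nu> {h} \<le> measure \<mu> {h} then 1 else -1 :: real)" for h
  define u where "u x = (\<Sum>h\<in>H. s h * indicator {h} x)" for x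
  have u: "u x = (if x \<in> H then s x else 0)" for x
    unfolding u_def using H(1) by (simp add: indicator_def if_distrib sum.delta cong: if_cong)
  have int: "(\<integral>x. u x \<partial>\<rho>) = (\<Sum>h\<in>H. s h * measure \<rho> {h})"
    if "prob_space \<rho>" "sets \<rho> = Pow C" for \<rho>
  proof -
    interpret prob_space \<rho> by fact
    have "\<And>h. h \<in> H \<Longrightarrow> {h} \<in> sets \<rho>" using that H by auto
    then show ?thesis unfolding u_def
      by (subst Bochner_Integration.integral_sum) (auto simp: emeasure_eq_measure)
  qed
  have sp: "space \<mu> = C" "space \<nu> = C" using \<mu> \<nu> by (metis Pow_UNIV sets_eq_imp_space_eq space_count_space sets_count_space)+
  have "(\<Sum>h\<in>H. \<bar>measure \<mu> {h} - measure \<nu> {h}\<bar>) = (\<integral>x. u x \<partial>\<mu>) - (\<integral>x. u x \<partial>\<nu>)"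
    unfolding int[OF \<mu>] int[OF \<nu>] sum_subtractf[symmetric]
    by (intro sum.cong) (auto simp: s_def)
  also have "\<dots> \<le> \<bar>(\<integral>x. u x \<partial>\<mu>) - (\<integral>x. u x \<partial>\<nu>)\<bar>" by simp
  also have "\<dots> \<le> Prob_dist (discrete_topology C) \<mu> \<nu>"
    using \<mu> \<nu> sp H(1)
    by (intro Prob_dist_upper C0_discrete_finite_support[of H]) (auto simp: u s_def)
  finally show ?thesis .
qed

text \<open>Compactness of \<open>Y\<close> upgrades tightness at single points to one finite
  \<open>Q\<close> for all points: the sets \<open>V H\<close> are open since finite sums of
  coordinates are continuous. The final estimate allows any finite \<open>H\<close> because right
  translation moves the support \<open>Q\<close>.\<close>

lemma amenable_finite_kernel:
  fixes Y :: "'a::metric_space set"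
  assumes G: "group G" and Y: "compact Y"
    and a: "\<And>\<gamma> y. \<gamma> \<in> carrier G \<Longrightarrow> y \<in> Y \<Longrightarrow> a \<gamma> y \<in> Y"
    and am: "amenable_action G (top_of_set Y) a"
    and F: "finite F" "F \<subseteq> carrier G" and \<epsilon>: "0 < \<epsilon>"
  obtains Q p where "finite Q" "Q \<subseteq> carrier G"
    "\<And>y g. y \<in> Y \<Longrightarrow> 0 \<le> p y g" "\<And>y g. y \<in> Y \<Longrightarrow> g \<notin> Q \<Longrightarrow> p y g = 0"
    "\<And>y. y \<in> Y \<Longrightarrow> (\<Sum>g\<in>Q. p y g) = (1::real)" "\<And>g. continuous_on Y (\<lambda>y. p y g)"
    "\<And>\<gamma> y H. \<gamma> \<in> F \<Longrightarrow> y \<in> Y \<Longrightarrow> finite H \<Longrightarrow> H \<subseteq> carrier G \<Longrightarrow>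
       (\<Sum>g\<in>H. \<bar>p y (g \<otimes>\<^bsub>G\<^esub> \<gamma>) - p (a \<gamma> y) g\<bar>) \<le> \<epsilon>"
proof -
  interpret group G by fact
  let ?D = "discrete_topology (carrier G)"
  from am obtain \<mu> where \<mu>: "\<And>n. weak_star_continuous (top_of_set Y) ?D (\<mu> n)"
    and lim: "\<And>\<gamma>. \<gamma> \<in> carrier G \<Longrightarrow> uniform_limit Y
       (\<lambda>n y. Prob_dist ?D (translate G \<gamma> (\<mu> n y)) (\<mu> n (a \<gamma> y))) (\<lambda>_. 0) sequentially"
    by (auto simp: amenable_action_def Let_def)
  have "\<forall>\<^sub>F n in sequentially. \<forall>\<gamma>\<in>F. \<forall>y\<in>Y.
      dist (Prob_dist ?D (translate G \<gamma> (\<mu> n y)) (\<mu> n (a \<gamma> y))) 0 < \<epsilon> / 2"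
    using F lim \<epsilon> by (intro eventually_ball_finite ballI uniform_limitD) auto
  then obtain n where n: "\<And>\<gamma> y. \<gamma> \<in> F \<Longrightarrow> y \<in> Y \<Longrightarrow>
      dist (Prob_dist ?D (translate G \<gamma> (\<mu> n y)) (\<mu> n (a \<gamma> y))) 0 < \<epsilon> / 2"
    by (auto dest!: eventually_happens)
  have Pr: "\<mu> n y \<in> Prob ?D" if "y \<in> Y" for y
    using \<mu>[of n] that by (auto simp: weak_star_continuous_def)
  define q where "q y g = measure (\<mu> n y) {g}" for y g
  have q0: "0 \<le> q y g" for y g by (simp add: q_def)
  have q1: "(\<Sum>g\<in>H. q y g) \<le> 1" if "y \<in> Y" "finite H" "H \<subseteq> carrier G" for y H
    unfolding q_def using Prob_discrete_sum(2)[OF Pr] that by auto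
  \<comment> \<open>Point indicators are \<open>C0\<close> functions on the discrete group; through
    them weak-star continuity reaches the individual coordinates.\<close>
  have qc: "continuous_on Y (\<lambda>y. q y g)" if "g \<in> carrier G" for g
  proof -
    have "indicat_real {g} \<in> C0 ?D"
      by (rule C0_discrete_finite_support[of "{g}"]) auto
    then have "continuous_on Y (\<lambda>y. \<integral>z. indicat_real {g} z \<partial>\<mu> n y)"
      using \<mu>[of n] by (auto simp: weak_star_continuous_def)
    then show ?thesis
    proof (rule continuous_on_cong[THEN iffD1, rotated -1])
      fix y assume "y \<in> Y"
      then show "(\<integral>z. indicat_real {g} z \<partial>\<mu> n y) = q y g"
        using ProbD[OF Pr] Prob_discrete_sets[OF Pr] that by (simp add: q_def)
    qed simp
  qed
  \<comment> \<open>Truncation is paid twice, at \<open>y\<close> and at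
    \<open>a \<gamma> y\<close>, each time at most \<open>2 * \<eta>\<close>; this leaves
    \<open>\<epsilon> / 2\<close> for amenability itself.\<close>
  define \<eta> where "\<eta> = \<epsilon> / 8"
  have \<eta>: "0 < \<eta>" using \<epsilon> by (simp add: \<eta>_def)
  define V where "V H = {y\<in>Y. 1 - \<eta> < (\<Sum>g\<in>H. q y g)}" for H
  define \<H> where "\<H> = {H. finite H \<and> H \<subseteq> carrier G}"
  have "openin (top_of_set Y) (V H)" if "H \<in> \<H>" for H
  proof -
    have "continuous_on Y (\<lambda>y. \<Sum>g\<in>H. q y g)"
      using that qc by (intro continuous_on_sum) (auto simp: \<H>_def)
    from continuous_openin_preimage_gen[OF this open_greaterThan[of "1 - \<eta>"]]
    show ?thesis by (simp add: V_def vimage_def Int_def greaterThan_def)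
  qed
  moreover have "Y \<subseteq> \<Union>(V ` \<H>)"
  proof
    fix y assume y: "y \<in> Y"
    obtain H where "finite H" "H \<subseteq> carrier G" "1 - \<eta> < (\<Sum>h\<in>H. measure (\<mu> n y) {h})"
      using Prob_discrete_tight[OF Pr[OF y], of "1 - \<eta>"] \<eta> by auto
    then show "y \<in> \<Union>(V ` \<H>)" using y by (auto simp: V_def \<H>_def q_def)
  qed
  ultimately obtain \<D> where \<D>: "\<D> \<subseteq> V ` \<H>" "finite \<D>" "Y \<subseteq> \<Union>\<D>"
    using Y unfolding compact_eq_openin_cover by (metis (no_types, lifting) imageE)
  then obtain \<K> where \<K>: "\<K> \<subseteq> \<H>" "finite \<K>" "Y \<subseteq> \<Union>(V ` \<K>)"
    by (metis finite_subset_image)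
  define Q where "Q = insert \<one>\<^bsub>G\<^esub> (\<Union>\<K>)"
  have Q: "finite Q" "Q \<subseteq> carrier G" "\<one>\<^bsub>G\<^esub> \<in> Q" using \<K> by (auto simp: Q_def \<H>_def)
  have Qmass: "1 - \<eta> < (\<Sum>g\<in>Q. q y g)" if "y \<in> Y" for y
  proof -
    from \<K>(3) that obtain H where H: "H \<in> \<K>" and "1 - \<eta> < (\<Sum>g\<in>H. q y g)" by (auto simp: V_def)
    note this(2)
    also have "\<dots> \<le> (\<Sum>g\<in>Q. q y g)" using Q H by (intro sum_mono2) (auto simp: q0 Q_def)
    finally show ?thesis .
  qed
  \<comment> \<open>Truncate \<open>q y\<close> to \<open>Q\<close> and move the lost mass \<open>r y\<close> to the identity, which keeps continuity.\<close>
  define r where "r y = 1 - (\<Sum>g\<in>Q. q y g)" for y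
  have r: "0 \<le> r y" "r y \<le> \<eta>" if "y \<in> Y" for y
    using q1[OF that Q(1,2)] Qmass[OF that] by (auto simp: r_def)
  define p where "p y g = (if g \<in> Q then q y g else 0) + (if g = \<one>\<^bsub>G\<^esub> then r y else 0)" for y g
  \<comment> \<open>One \<open>\<eta>\<close> is the mass that \<open>q y\<close> has outside
    \<open>Q\<close>, the other the mass \<open>r y\<close> added at the identity.\<close>
  have close: "(\<Sum>g\<in>H. \<bar>p y g - q y g\<bar>) \<le> 2 * \<eta>"
    if y: "y \<in> Y" and H: "finite H" "H \<subseteq> carrier G" for y H
  proof -
    have "(\<Sum>g\<in>H. \<bar>p y g - q y g\<bar>) \<le> (\<Sum>g\<in>H. (if g \<in> Q then 0 else q y g) + (if g = \<one>\<^bsub>G\<^esub> then r y else 0))"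
      using r(1)[OF y] q0 Q(3) by (intro sum_mono) (auto simp: p_def)
    also have "\<dots> = (\<Sum>g\<in>H - Q. q y g) + (\<Sum>g\<in>H. if g = \<one>\<^bsub>G\<^esub> then r y else 0)"
      using H by (simp add: sum.distrib sum.If_cases Diff_eq)
    also have "(\<Sum>g\<in>H. if g = \<one>\<^bsub>G\<^esub> then r y else 0) \<le> \<eta>"
      using H r[OF y] \<eta> by (simp add: sum.delta)
    also have "(\<Sum>g\<in>H - Q. q y g) \<le> \<eta>"
    proof -
      have "(\<Sum>g\<in>H - Q. q y g) + (\<Sum>g\<in>Q. q y g) = (\<Sum>g\<in>(H - Q) \<union> Q. q y g)"
        using H Q by (subst sum.union_disjoint) auto
      also have "\<dots> \<le> 1" using H Q y by (intro q1) auto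
      finally show ?thesis using Qmass[OF y] by simp
    qed
    finally show ?thesis by simp
  qed
  show thesis
  proof (rule that[of Q p])
    show "finite Q" "Q \<subseteq> carrier G" by fact+
    show "0 \<le> p y g" if "y \<in> Y" for y g using r(1)[OF that] q0 by (simp add: p_def)
    show "p y g = 0" if "g \<notin> Q" for y g using that Q(3) by (auto simp: p_def)
    show "(\<Sum>g\<in>Q. p y g) = 1" for y
      using Q by (simp add: p_def sum.distrib sum.delta r_def)
    show "continuous_on Y (\<lambda>y. p y g)" for g
    proof -
      have "continuous_on Y (\<lambda>y. if g \<in> Q then q y g else 0)"
        using qc[of g] Q by (cases "g \<in> Q") auto
      moreover have "continuous_on Y r"
        unfolding r_def using Q qc by (intro continuous_intros) auto
      then have "continuous_on Y (\<lambda>y. if g = \<one>\<^bsub>G\<^esub> then r y else 0)"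
        by (cases "g = \<one>\<^bsub>G\<^esub>") auto
      ultimately show ?thesis unfolding p_def by (rule continuous_on_add)
    qed
    fix \<gamma> y H assume \<gamma>: "\<gamma> \<in> F" and y: "y \<in> Y" and H: "finite H" "H \<subseteq> carrier G"
    have \<gamma>G: "\<gamma> \<in> carrier G" and ay: "a \<gamma> y \<in> Y" using \<gamma> F a y by auto
    \<comment> \<open>Right translation by \<open>\<gamma>\<close> is injective, so this is the
      truncation error at \<open>y\<close> summed over the translate of \<open>H\<close>.\<close>
    have "(\<Sum>g\<in>H. \<bar>p y (g \<otimes>\<^bsub>G\<^esub> \<gamma>) - q y (g \<otimes>\<^bsub>G\<^esub> \<gamma>)\<bar>)
        = (\<Sum>g\<in>(\<lambda>g. g \<otimes>\<^bsub>G\<^esub> \<gamma>) ` H. \<bar>p y g - q y g\<bar>)"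
      using H \<gamma>G by (subst sum.reindex) (auto simp: inj_on_def subset_iff)
    also have "\<dots> \<le> 2 * \<eta>" using y H \<gamma>G by (intro close) auto
    finally have 1: "(\<Sum>g\<in>H. \<bar>p y (g \<otimes>\<^bsub>G\<^esub> \<gamma>) - q y (g \<otimes>\<^bsub>G\<^esub> \<gamma>)\<bar>) \<le> 2 * \<eta>" .
    have 2: "(\<Sum>g\<in>H. \<bar>p (a \<gamma> y) g - q (a \<gamma> y) g\<bar>) \<le> 2 * \<eta>"
      using ay H by (rule close)
    have tr: "(\<lambda>g. g \<otimes>\<^bsub>G\<^esub> inv\<^bsub>G\<^esub> \<gamma>) \<in> measurable (\<mu> n y) (\<mu> n y)"
      using ProbD[OF Pr[OF y]] Prob_discrete_sets[OF Pr[OF y]] \<gamma>G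
      by (auto simp: measurable_def)
    have "(\<Sum>g\<in>H. \<bar>q y (g \<otimes>\<^bsub>G\<^esub> \<gamma>) - q (a \<gamma> y) g\<bar>)
        = (\<Sum>g\<in>H. \<bar>measure (translate G \<gamma> (\<mu> n y)) {g} - measure (\<mu> n (a \<gamma> y)) {g}\<bar>)"
      unfolding q_def using H \<gamma>G measure_translate_singleton[OF G Pr[OF y] \<gamma>G]
      by (intro sum.cong) (auto simp: subset_iff)
    also have "\<dots> \<le> Prob_dist ?D (translate G \<gamma> (\<mu> n y)) (\<mu> n (a \<gamma> y))"
    proof (rule sum_le_Prob_dist_discrete)
      show "prob_space (translate G \<gamma> (\<mu> n y))" unfolding translate_def
        using ProbD[OF Pr[OF y]] tr by (intro prob_space.prob_space_distr) auto
    qed (use ProbD[OF Pr] Prob_discrete_sets[OF Pr] y ay H in \<open>auto simp: translate_def\<close>)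
    also have "\<dots> \<le> \<epsilon> / 2" using n[OF \<gamma> y] by (simp add: dist_real_def)
    finally have 3: "(\<Sum>g\<in>H. \<bar>q y (g \<otimes>\<^bsub>G\<^esub> \<gamma>) - q (a \<gamma> y) g\<bar>) \<le> \<epsilon> / 2" .
    have "(\<Sum>g\<in>H. \<bar>p y (g \<otimes>\<^bsub>G\<^esub> \<gamma>) - p (a \<gamma> y) g\<bar>)
        \<le> (\<Sum>g\<in>H. \<bar>p y (g \<otimes>\<^bsub>G\<^esub> \<gamma>) - q y (g \<otimes>\<^bsub>G\<^esub> \<gamma>)\<bar>
            + \<bar>q y (g \<otimes>\<^bsub>G\<^esub> \<gamma>) - q (a \<gamma> y) g\<bar> + \<bar>p (a \<gamma> y) g - q (a \<gamma> y) g\<bar>)"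
      by (intro sum_mono) linarith
    also have "\<dots> \<le> \<epsilon>" using 1 2 3 by (simp add: sum.distrib \<eta>_def)
    finally show "(\<Sum>g\<in>H. \<bar>p y (g \<otimes>\<^bsub>G\<^esub> \<gamma>) - p (a \<gamma> y) g\<bar>) \<le> \<epsilon>" .
  qed
qed


section \<open>Slowly varying weights on Euclidean space\<close>

definition cell :: "'a::euclidean_space \<Rightarrow> 'a" where
  "cell u = (\<Sum>b\<in>Basis. of_int \<lfloor>u \<bullet> b\<rfloor> *\<^sub>R b)"

text \<open>\<open>bump M x k\<close> is the fraction of the ball of radius \<open>M\<close> about \<open>x\<close> that lies in the unit lattice
  cube with lowest corner \<open>k\<close>.\<close>

definition bump :: "real \<Rightarrow> 'a::euclidean_space \<Rightarrow> 'a \<Rightarrow> real" where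
  "bump M x k = measure lborel (ball x M \<inter> cell -` {k}) / measure lborel (ball (0::'a) M)"

lemma cell_borel [measurable]: "cell \<in> borel_measurable borel"
  unfolding cell_def by measurable

lemma dist_cell_le: "dist (cell u) (u::'a::euclidean_space) \<le> DIM('a)"
proof -
  have "\<bar>(cell u - u) \<bullet> b\<bar> \<le> 1" if "b \<in> Basis" for b
    using that by (simp add: cell_def inner_diff_left inner_sum_left_Basis) linarith
  then have "(\<Sum>b\<in>Basis. \<bar>(cell u - u) \<bullet> b\<bar>) \<le> of_nat (card (Basis :: 'a set)) * 1"
    by (intro sum_bounded_above) auto
  then show ?thesis using norm_le_l1[of "cell u - u"] by (simp add: dist_norm)
qed

lemma finite_cell_image:
  assumes "bounded (B :: 'a::euclidean_space set)"
  shows "finite (cell ` B)"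
proof -
  obtain c where c: "\<And>u. u \<in> B \<Longrightarrow> norm u \<le> c" using assms by (auto simp: bounded_iff)
  define J where "J = {\<lfloor>- c\<rfloor>..\<lfloor>c\<rfloor>}"
  have "cell u \<in> (\<lambda>f. \<Sum>b\<in>Basis. of_int (f b) *\<^sub>R b) ` (Basis \<rightarrow>\<^sub>E J)" if "u \<in> B" for u
  proof (rule image_eqI)
    show "cell u = (\<Sum>b\<in>Basis. of_int (restrict (\<lambda>b. \<lfloor>u \<bullet> b\<rfloor>) Basis b) *\<^sub>R b)"
      by (simp add: cell_def)
    have "- c \<le> u \<bullet> b" "u \<bullet> b \<le> c" if "b \<in> Basis" for b
      using Basis_le_norm[OF that, of u] c[OF \<open>u \<in> B\<close>] by linarith+
    then show "restrict (\<lambda>b. \<lfloor>u \<bullet> b\<rfloor>) Basis \<in> Basis \<rightarrow>\<^sub>E J"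
      by (auto simp: J_def intro!: floor_mono)
  qed
  moreover have "finite (Basis \<rightarrow>\<^sub>E J :: ('a \<Rightarrow> int) set)"
    by (intro finite_PiE) (auto simp: J_def)
  ultimately show ?thesis by (meson finite_imageI finite_subset image_subsetI)
qed

lemma measure_ball_eq:
  "0 \<le> M \<Longrightarrow> measure lborel (ball (x::'a::euclidean_space) M) = unit_ball_vol DIM('a) * M ^ DIM('a)"
  by (simp add: measure_def emeasure_ball)

lemma emeasure_ball_finite: "emeasure lborel (ball (x::'a::euclidean_space) M) < \<infinity>"
  using emeasure_bounded_finite[OF bounded_ball] .

lemma measure_ball_pos: "0 < M \<Longrightarrow> 0 < measure lborel (ball (x::'a::euclidean_space) M)"
  by (simp add: measure_ball_eq)

lemma bump_nonneg: "0 \<le> bump M x k"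
  by (simp add: bump_def)

lemma bump_nonzero_cell:
  assumes "bump M x k \<noteq> 0" shows "k \<in> cell ` ball x M"
proof (rule ccontr)
  assume "k \<notin> cell ` ball x M"
  then have "ball x M \<inter> cell -` {k} = {}" by blast
  then show False using assms by (simp add: bump_def)
qed

lemma bump_nonzero_dist:
  assumes "bump M (x::'a::euclidean_space) k \<noteq> 0" shows "dist x k \<le> M + DIM('a)"
proof -
  from bump_nonzero_cell[OF assms] obtain u where "dist x u < M" "k = cell u" by auto
  then show ?thesis using dist_cell_le[of u] dist_triangle[of x k u] by (simp add: dist_commute)
qed

lemma sum_measure_cells:
  assumes "finite A" "B \<in> sets borel" "bounded (B :: 'a::euclidean_space set)"
  shows "(\<Sum>k\<in>A. measure lborel (B \<inter> cell -` {k})) = measure lborel (B \<inter> cell -` A)"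
proof -
  have s: "B \<inter> cell -` {k} \<in> sets borel" for k
    using assms(2) measurable_sets[OF cell_borel, of "{k}"] by (auto intro!: sets.Int)
  have "measure lborel (\<Union>k\<in>A. B \<inter> cell -` {k}) = (\<Sum>k\<in>A. measure lborel (B \<inter> cell -` {k}))"
  proof (rule measure_finite_Union)
    show "emeasure lborel (B \<inter> cell -` {k}) \<noteq> \<infinity>" for k
      using emeasure_bounded_finite[of "B \<inter> cell -` {k}"] assms(3)
      by (simp add: bounded_Int)
  qed (use assms s in \<open>auto simp: disjoint_family_on_def\<close>)
  moreover have "(\<Union>k\<in>A. B \<inter> cell -` {k}) = B \<inter> cell -` A" by blast
  ultimately show ?thesis by simp
qed

text \<open>The cubes partition space, and by translation invariance the ball about 0 in the
  denominator has the volume of the ball about \<open>x\<close>.\<close>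

lemma sum_bump:
  assumes "finite A" "cell ` ball x M \<subseteq> A" "0 < M"
  shows "(\<Sum>k\<in>A. bump M x k) = 1"
proof -
  have "(\<Sum>k\<in>A. bump M x k) = measure lborel (ball x M \<inter> cell -` A) / measure lborel (ball (0::'a) M)"
    unfolding bump_def sum_divide_distrib[symmetric]
    using assms by (subst sum_measure_cells) auto
  also have "ball x M \<inter> cell -` A = ball x M" using assms by blast
  finally show ?thesis using assms unit_ball_vol_pos[of "DIM('a)"]
    by (simp add: measure_ball_eq[of M x] measure_ball_eq[of M 0] del: unit_ball_vol_pos)
qed

lemma sum_bump_le_1:
  assumes "finite A" "0 < M"
  shows "(\<Sum>k\<in>A. bump M (x::'a::euclidean_space) k) \<le> 1"
proof -
  have "(\<Sum>k\<in>A. bump M x k) \<le> (\<Sum>k\<in>A \<union> cell ` ball x M. bump M x k)"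
    using assms finite_cell_image[OF bounded_ball] by (intro sum_mono2) (auto simp: bump_nonneg)
  also have "\<dots> = 1" using assms finite_cell_image[OF bounded_ball] by (intro sum_bump) auto
  finally show ?thesis .
qed

text \<open>The difference lies in the shell between the radii \<open>M - dist x x'\<close> and
  \<open>M\<close> about \<open>x\<close>, whose share of the ball is at most
  \<open>DIM('a) * dist x x' / M\<close> by Bernoulli's inequality. For \<open>dist x x' > M\<close>
  the right side is at least the volume of the whole ball.\<close>

lemma measure_ball_Diff_le:
  fixes x x' :: "'a::euclidean_space"
  assumes M: "0 < M"
  shows "measure lborel (ball x M - ball x' M) \<le> measure lborel (ball (0::'a) M) * (DIM('a) * dist x x' / M)"
proof (cases "dist x x' \<le> M")
  case True
  let ?d = "dist x x'" and ?V = "measure lborel (ball (0::'a) M)"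
  have "ball x M - ball x' M \<subseteq> ball x M - ball x (M - ?d)"
    using dist_triangle[of x'] by (auto simp: dist_commute) 
      (smt (verit) dist_commute dist_triangle)
  then have "measure lborel (ball x M - ball x' M) \<le> measure lborel (ball x M - ball x (M - ?d))"
    using emeasure_bounded_finite[of "ball x M - ball x (M - ?d)"]
    by (intro measure_mono_fmeasurable) (auto simp: fmeasurable_def bounded_diff)
  also have "\<dots> = ?V - measure lborel (ball x (M - ?d))"
    using M True emeasure_ball_finite[of x M] subset_ball[of "M - ?d" M x]
    by (subst measure_Diff) (auto simp: measure_ball_eq subset_ball)
  also have "\<dots> = ?V * (1 - (1 + (- ?d / M)) ^ DIM('a))"
  proof -
    have "M - ?d = M * (1 + (- ?d / M))" using M by (simp add: algebra_simps)
    then have "(M - ?d) ^ DIM('a) = M ^ DIM('a) * (1 + (- ?d / M)) ^ DIM('a)"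
      by (simp only: power_mult_distrib)
    moreover have "measure lborel (ball x (M - ?d)) = unit_ball_vol DIM('a) * (M - ?d) ^ DIM('a)"
      using True by (simp add: measure_ball_eq)
    moreover have "?V = unit_ball_vol DIM('a) * M ^ DIM('a)"
      using M by (simp add: measure_ball_eq)
    ultimately show ?thesis by (simp only: right_diff_distrib mult_1_right mult.assoc)
  qed
  also have "\<dots> \<le> ?V * (DIM('a) * ?d / M)"
    using Bernoulli_inequality[of "- ?d / M" "DIM('a)"] True M
    by (intro mult_left_mono) auto
  finally show ?thesis .
next
  case False
  let ?d = "dist x x'" and ?V = "measure lborel (ball (0::'a) M)"
  have "measure lborel (ball x M - ball x' M) \<le> measure lborel (ball x M)"
    using emeasure_bounded_finite[of "ball x M"]
    by (intro measure_mono_fmeasurable) (auto simp: fmeasurable_def)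
  also have "\<dots> = ?V * 1" using M by (simp add: measure_ball_eq)
  also have "\<dots> \<le> ?V * (DIM('a) * ?d / M)"
  proof (intro mult_left_mono)
    have "1 * M \<le> DIM('a) * ?d"
      using False M by (intro mult_mono) (auto simp: DIM_positive Suc_leI)
    then show "1 \<le> DIM('a) * ?d / M" using M by simp
  qed auto
  finally show ?thesis .
qed

text \<open>Within each cube the part common to both balls cancels, so a cube contributes at most
  its share of the two set differences. Since the cubes are disjoint, the sum is bounded
  independently of the number of labels.\<close>

lemma sum_bump_diff_le:
  fixes x x' :: "'a::euclidean_space"
  assumes A: "finite A" and M: "0 < M"
  shows "(\<Sum>k\<in>A. \<bar>bump M x k - bump M x' k\<bar>) \<le> 2 * DIM('a) * dist x x' / M"
proof -
  let ?V = "measure lborel (ball (0::'a) M)" and ?m = "measure (lborel :: 'a measure)"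
  have V: "?V > 0" using M by (rule measure_ball_pos)
  let ?D = "ball x M - ball x' M" and ?D' = "ball x' M - ball x M"
  have s: "B \<inter> cell -` {k} \<in> fmeasurable lborel" if "B \<in> sets borel" "bounded B" for k and B :: "'a set"
    using emeasure_bounded_finite[of "B \<inter> cell -` {k}"] that
      measurable_sets[OF cell_borel, of "{k}"] by (auto simp: fmeasurable_def intro!: sets.Int)
  have *: "\<bar>?m (ball x M \<inter> cell -` {k}) - ?m (ball x' M \<inter> cell -` {k})\<bar>
      \<le> ?m (?D \<inter> cell -` {k}) + ?m (?D' \<inter> cell -` {k})" for k
  proof -
    have "?m (B \<inter> cell -` {k}) = ?m ((B - B') \<inter> cell -` {k}) + ?m ((B \<inter> B') \<inter> cell -` {k})"
      if "B \<in> sets borel" "bounded B" "B' \<in> sets borel" for B B' :: "'a set"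
    proof -
      have "B \<inter> cell -` {k} = ((B - B') \<inter> cell -` {k}) \<union> ((B \<inter> B') \<inter> cell -` {k})" by blast
      then show ?thesis using s[of "B - B'" k] s[of "B \<inter> B'" k] that
        by (subst (1) \<open>B \<inter> cell -` {k} = _\<close>, subst measure_Union)
          (auto simp: fmeasurable_def bounded_diff bounded_Int)
    qed
    from this[of "ball x M" "ball x' M"] this[of "ball x' M" "ball x M"] show ?thesis
      by (simp add: Int_commute) (smt (verit) measure_nonneg)
  qed
  have "(\<Sum>k\<in>A. \<bar>bump M x k - bump M x' k\<bar>)
      = (\<Sum>k\<in>A. \<bar>?m (ball x M \<inter> cell -` {k}) - ?m (ball x' M \<inter> cell -` {k})\<bar>) / ?V"
    unfolding bump_def sum_divide_distrib using V
    by (intro sum.cong) (auto simp flip: diff_divide_distrib)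
  also have "\<dots> \<le> (\<Sum>k\<in>A. ?m (?D \<inter> cell -` {k}) + ?m (?D' \<inter> cell -` {k})) / ?V"
    using V * by (intro divide_right_mono sum_mono) auto
  also have "(\<Sum>k\<in>A. ?m (?D \<inter> cell -` {k}) + ?m (?D' \<inter> cell -` {k}))
      = ?m (?D \<inter> cell -` A) + ?m (?D' \<inter> cell -` A)"
    using A by (simp add: sum.distrib sum_measure_cells bounded_diff)
  also have "\<dots> \<le> ?m ?D + ?m ?D'"
  proof (intro add_mono measure_mono_fmeasurable)
    have "cell -` A \<in> sets (borel :: 'a measure)"
      using measurable_sets[OF cell_borel, of A] A by (simp add: finite_imp_closed borel_closed)
    then show "?D \<inter> cell -` A \<in> sets lborel" "?D' \<inter> cell -` A \<in> sets lborel" by auto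
    show "?D \<in> fmeasurable lborel" "?D' \<in> fmeasurable lborel"
      using emeasure_bounded_finite by (auto simp: fmeasurable_def bounded_diff)
  qed auto
  also have "\<dots> \<le> ?V * (DIM('a) * dist x x' / M) + ?V * (DIM('a) * dist x' x / M)"
    using M by (intro add_mono measure_ball_Diff_le)
  finally show ?thesis using V by (simp add: divide_right_mono dist_commute field_simps)
qed

lemma continuous_bump:
  assumes "0 < M" shows "continuous_on UNIV (\<lambda>x::'a::euclidean_space. bump M x k)"
proof (rule lipschitz_on_continuous_on)
  show "(2 * DIM('a) / M)-lipschitz_on UNIV (\<lambda>x::'a. bump M x k)"
    using sum_bump_diff_le[of "{k}" M] assms by (auto simp: lipschitz_on_def dist_real_def)
qed


section \<open>Geometry of the warped cone\<close>

text \<open>Passing from \<open>t'\<close> to \<open>t\<close> costs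
  \<open>\<bar>t' - t\<bar>\<close>, itself at most the distance; hence the factor 2. Read as a
  bound on \<open>dist y y'\<close>, it says that a fixed Euclidean move at radius \<open>t\<close>
  changes the direction by \<open>O(1/t)\<close>.\<close>

lemma norm_scaleR_diff_le:
  fixes y y' :: "'a::real_normed_vector"
  assumes "norm y = 1" "norm y' = 1" "0 \<le> t" "0 \<le> t'"
  shows "t * dist y y' \<le> 2 * dist (t *\<^sub>R y) (t' *\<^sub>R y')"
proof -
  have "t * dist y y' = norm ((t *\<^sub>R y - t' *\<^sub>R y') + (t' - t) *\<^sub>R y')"
    using assms by (simp add: dist_norm algebra_simps flip: norm_scaleR scaleR_diff_right)
      (metis abs_of_nonneg norm_scaleR scaleR_diff_right)
  also have "\<dots> \<le> dist (t *\<^sub>R y) (t' *\<^sub>R y') + \<bar>t' - t\<bar>"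
    using norm_triangle_ineq[of "t *\<^sub>R y - t' *\<^sub>R y'" "(t' - t) *\<^sub>R y'"] assms
    by (simp add: dist_norm)
  also have "\<bar>t' - t\<bar> \<le> dist (t *\<^sub>R y) (t' *\<^sub>R y')"
    using norm_triangle_ineq3[of "t *\<^sub>R y" "t' *\<^sub>R y'"] assms by (simp add: dist_norm)
  finally show ?thesis by simp
qed

text \<open>Each 1/2-ball of a finite cover contains at most one point of a 1-separated set.
  Covering the ball about 0 and translating makes the bound independent of \<open>x\<close>.\<close>

lemma separated_card_bound:
  "\<exists>s. \<forall>x::'a::euclidean_space. \<forall>A \<subseteq> cball x R.
     (\<forall>p\<in>A. \<forall>q\<in>A. p \<noteq> q \<longrightarrow> 1 \<le> dist p q) \<longrightarrow> finite A \<and> card A \<le> s"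
proof -
  obtain T :: "'a set" where T: "finite T" "cball 0 R \<subseteq> (\<Union>t\<in>T. ball t (1/2))"
  proof -
    have "\<forall>e>0. \<exists>k. finite k \<and> cball (0::'a) R \<subseteq> (\<Union>x\<in>k. ball x e)"
      using compact_cball[of "0::'a" R] unfolding compact_eq_totally_bounded by (rule conjunct2)
    from this[rule_format, of "1/2"] show ?thesis using that by force
  qed
  have "finite A \<and> card A \<le> card T"
    if A: "A \<subseteq> cball x R" "\<And>p q. p \<in> A \<Longrightarrow> q \<in> A \<Longrightarrow> p \<noteq> q \<Longrightarrow> 1 \<le> dist p q" for x :: 'a and A
  proof -
    have "\<exists>t\<in>T. p - x \<in> ball t (1/2)" if "p \<in> A" for p
    proof -
      have "p - x \<in> cball 0 R" using that A(1) by (auto simp: dist_norm norm_minus_commute)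
      then show ?thesis using T(2) by blast
    qed
    then obtain h where h: "\<And>p. p \<in> A \<Longrightarrow> h p \<in> T \<and> dist (h p) (p - x) < 1/2"
      unfolding mem_ball Bex_def by metis
    have "inj_on h A"
    proof (rule inj_onI, rule ccontr)
      fix p q assume pq: "p \<in> A" "q \<in> A" "h p = h q" "p \<noteq> q"
      have "dist p q = dist (p - x) (q - x)" by (simp add: dist_norm)
      also have "\<dots> \<le> dist (h p) (p - x) + dist (h p) (q - x)" by (rule dist_triangle3)
      also have "\<dots> < 1" using h[OF pq(1)] h[OF pq(2), folded pq(3)] by linarith
      finally show False using A(2)[OF pq(1,2,4)] by linarith
    qed
    moreover have "h ` A \<subseteq> T" using h by blast
    ultimately show ?thesis using T(1) card_inj_on_le inj_on_finite by blast
  qed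
  then show ?thesis by (intro exI[of _ "card T"] allI impI) blast
qed

section \<open>The open cone in polar coordinates and the action on it\<close>

locale warped_cone =
  fixes Y :: "'a::euclidean_space set" and \<Gamma> :: "('g, 'm) monoid_scheme"
    and a :: "'g \<Rightarrow> 'a \<Rightarrow> 'a" and S :: "'g set"
  assumes compact_Y: "compact Y" and Y_sphere: "Y \<subseteq> sphere 0 1"
    and group_action: "group_action \<Gamma> Y a"
    and finite_S: "finite S" and S_carrier: "S \<subseteq> carrier \<Gamma>"
    and generate_S: "generate \<Gamma> S = carrier \<Gamma>"
    and lipschitz: "\<forall>\<gamma>\<in>carrier \<Gamma>. lipschitz_homeomorphism_on Y (a \<gamma>)"
begin

sublocale group \<Gamma>
  using group_action by (simp add: group_action_def group_hom_def)

abbreviation "X \<equiv> open_cone Y"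
abbreviation "act \<equiv> cone_action a"
abbreviation "dw \<equiv> warped_metric X dist S act"

lemma norm_Y [simp]: "y \<in> Y \<Longrightarrow> norm y = 1"
  using Y_sphere by auto

lemma a_closed [simp]: "\<gamma> \<in> carrier \<Gamma> \<Longrightarrow> y \<in> Y \<Longrightarrow> a \<gamma> y \<in> Y"
  using group_action.element_image[OF group_action] by blast

lemma coneE:
  assumes "x \<in> X" obtains t y where "0 \<le> t" "y \<in> Y" "x = t *\<^sub>R y"
  using assms by (auto simp: open_cone_def)

lemma coneI: "0 \<le> t \<Longrightarrow> y \<in> Y \<Longrightarrow> t *\<^sub>R y \<in> X"
  by (auto simp: open_cone_def)

text \<open>The premise guarantees that \<open>Y\<close> is nonempty; the cone on the empty set is
  empty and has no apex.\<close>

lemma zero_in_cone: "x \<in> X \<Longrightarrow> 0 \<in> X"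
  by (metis coneE coneI order_refl scaleR_zero_left)

lemma proj_in_Y: "x \<in> X \<Longrightarrow> x \<noteq> 0 \<Longrightarrow> x /\<^sub>R norm x \<in> Y"
  by (auto elim!: coneE)

lemma act_scaleR: "y \<in> Y \<Longrightarrow> 0 \<le> t \<Longrightarrow> act \<gamma> (t *\<^sub>R y) = t *\<^sub>R a \<gamma> y"
  by (simp add: cone_action_scaleR)

lemma act_closed [simp]: "\<gamma> \<in> carrier \<Gamma> \<Longrightarrow> x \<in> X \<Longrightarrow> act \<gamma> x \<in> X"
  by (auto elim!: coneE intro!: coneI simp: act_scaleR)

lemma norm_act: "\<gamma> \<in> carrier \<Gamma> \<Longrightarrow> x \<in> X \<Longrightarrow> norm (act \<gamma> x) = norm x"
  by (auto elim!: coneE simp: act_scaleR)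

lemma act_mult:
  "\<gamma> \<in> carrier \<Gamma> \<Longrightarrow> \<gamma>' \<in> carrier \<Gamma> \<Longrightarrow> x \<in> X \<Longrightarrow> act (\<gamma> \<otimes>\<^bsub>\<Gamma>\<^esub> \<gamma>') x = act \<gamma> (act \<gamma>' x)"
  by (auto elim!: coneE simp: act_scaleR group_action.composition_rule[OF group_action])

lemma act_one: "x \<in> X \<Longrightarrow> act \<one>\<^bsub>\<Gamma>\<^esub> x = x"
  using group_action.id_eq_one[OF group_action]
  by (auto elim!: coneE simp: act_scaleR) (metis restrict_apply')

lemma act_inv: "\<gamma> \<in> carrier \<Gamma> \<Longrightarrow> x \<in> X \<Longrightarrow> act \<gamma> (act (inv\<^bsub>\<Gamma>\<^esub> \<gamma>) x) = x"
  "\<gamma> \<in> carrier \<Gamma> \<Longrightarrow> x \<in> X \<Longrightarrow> act (inv\<^bsub>\<Gamma>\<^esub> \<gamma>) (act \<gamma> x) = x"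
  by (simp_all add: act_mult[symmetric] act_one)

text \<open>Compare through \<open>t *\<^sub>R a \<gamma> y'\<close>: the change of direction costs
  at most \<open>L * (t * dist y y')\<close>, hence \<open>2 * L * dist x x'\<close>, and the change
  of radius at most \<open>dist x x'\<close>.\<close>

lemma act_lipschitz1:
  assumes \<gamma>: "\<gamma> \<in> carrier \<Gamma>"
  shows "\<exists>L. \<forall>x\<in>X. \<forall>x'\<in>X. dist (act \<gamma> x) (act \<gamma> x') \<le> L * dist x x'"
proof -
  from lipschitz \<gamma> obtain L where L: "L-lipschitz_on Y (a \<gamma>)"
    by (auto simp: lipschitz_homeomorphism_on_def)
  have L0: "0 \<le> L" using L by (rule lipschitz_on_nonneg)
  have "dist (act \<gamma> x) (act \<gamma> x') \<le> (1 + 2 * L) * dist x x'" if "x \<in> X" "x' \<in> X" for x x'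
  proof -
    from that obtain t y t' y' where *: "0 \<le> t" "y \<in> Y" "x = t *\<^sub>R y" "0 \<le> t'" "y' \<in> Y" "x' = t' *\<^sub>R y'"
      by (metis coneE)
    have "dist (act \<gamma> x) (act \<gamma> x') \<le> dist (t *\<^sub>R a \<gamma> y) (t *\<^sub>R a \<gamma> y') + dist (t *\<^sub>R a \<gamma> y') (t' *\<^sub>R a \<gamma> y')"
      unfolding * act_scaleR[OF *(2) *(1)] act_scaleR[OF *(5) *(4)] by (rule dist_triangle)
    also have "dist (t *\<^sub>R a \<gamma> y) (t *\<^sub>R a \<gamma> y') = t * dist (a \<gamma> y) (a \<gamma> y')"
      using * by (simp add: dist_norm flip: scaleR_diff_right)
    also have "dist (t *\<^sub>R a \<gamma> y') (t' *\<^sub>R a \<gamma> y') = \<bar>t - t'\<bar>"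
      using * \<gamma> by (simp add: dist_norm flip: scaleR_diff_left)
    also have "t * dist (a \<gamma> y) (a \<gamma> y') \<le> t * (L * dist y y')"
      using * lipschitz_onD[OF L] by (intro mult_left_mono) auto
    also have "t * (L * dist y y') = L * (t * dist y y')" by simp
    also have "\<dots> \<le> L * (2 * dist x x')"
      unfolding * using * L0 by (intro mult_left_mono norm_scaleR_diff_le) auto
    also have "\<bar>t - t'\<bar> \<le> dist x x'"
      using norm_triangle_ineq3[of "t *\<^sub>R y" "t' *\<^sub>R y'"] * by (simp add: dist_norm)
    finally show ?thesis by (simp add: algebra_simps)
  qed
  then show ?thesis by blast
qed

lemma act_lipschitz:
  assumes "finite F" "F \<subseteq> carrier \<Gamma>"
  shows "\<exists>L\<ge>1. \<forall>\<gamma>\<in>F. \<forall>x\<in>X. \<forall>x'\<in>X. dist (act \<gamma> x) (act \<gamma> x') \<le> L * dist x x'"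
proof -
  from act_lipschitz1 assms(2) have
    "\<forall>\<gamma>\<in>F. \<exists>L. \<forall>x\<in>X. \<forall>x'\<in>X. dist (act \<gamma> x) (act \<gamma> x') \<le> L * dist x x'"
    by blast
  then obtain L where L: "\<And>\<gamma> x x'. \<gamma> \<in> F \<Longrightarrow> x \<in> X \<Longrightarrow> x' \<in> X \<Longrightarrow>
      dist (act \<gamma> x) (act \<gamma> x') \<le> L \<gamma> * dist x x'"
    by metis
  \<comment> \<open>Inserting 1 keeps the set nonempty and makes the constant at least 1, so that
    \<open>L powr c\<close> will increase with \<open>c\<close>.\<close>
  have "L \<gamma> \<le> Max (insert 1 (L ` F))" if "\<gamma> \<in> F" for \<gamma>
    using assms that by (intro Max_ge) auto
  then have "dist (act \<gamma> x) (act \<gamma> x') \<le> Max (insert 1 (L ` F)) * dist x x'"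
    if "\<gamma> \<in> F" "x \<in> X" "x' \<in> X" for \<gamma> x x'
    using L[OF that] that by (meson mult_right_mono order_trans zero_le_dist)
  moreover have "1 \<le> Max (insert 1 (L ` F))" using assms by (intro Max_ge) auto
  ultimately show ?thesis by blast
qed

lemma continuous_act:
  assumes "\<gamma> \<in> carrier \<Gamma>"
  shows "continuous_on X (act \<gamma>)"
proof -
  obtain L where "1 \<le> L" "\<forall>x\<in>X. \<forall>x'\<in>X. dist (act \<gamma> x) (act \<gamma> x') \<le> L * dist x x'"
    using act_lipschitz[of "{\<gamma>}"] assms by auto
  then have "L-lipschitz_on X (act \<gamma>)" by (auto simp: lipschitz_on_def)
  then show ?thesis by (rule lipschitz_on_continuous_on)
qed

section \<open>First bounds and the topology of the warped metric\<close>

lemma gen_closed: "s \<in> S \<Longrightarrow> x \<in> X \<Longrightarrow> act s x \<in> X"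
  using S_carrier by auto

lemma Metric_space_cone: "Metric_space X dist"
  by (simp add: Met_TC.subspace)

lemma is_warped: "is_warped_metric X dist S act dw"
  unfolding warped_metric_def
  using someI_ex[OF is_warped_metric_exists[OF Metric_space_cone gen_closed]] .

lemma Metric_space_warped: "Metric_space X dw"
  using is_warped by (simp add: is_warped_metric_def warping_admissible_def)

sublocale W: Metric_space X dw
  by (rule Metric_space_warped)

lemma dw_le_dist: "x \<in> X \<Longrightarrow> x' \<in> X \<Longrightarrow> dw x x' \<le> dist x x'"
  using is_warped by (simp add: is_warped_metric_def warping_admissible_def)

lemma dw_gen: "x \<in> X \<Longrightarrow> s \<in> S \<Longrightarrow> dw x (act s x) \<le> 1"
  using is_warped by (simp add: is_warped_metric_def warping_admissible_def)

lemma dw_max: "warping_admissible X dist S act \<delta> \<Longrightarrow> x \<in> X \<Longrightarrow> x' \<in> X \<Longrightarrow> \<delta> x x' \<le> dw x x'"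
  using is_warped by (simp add: is_warped_metric_def)

text \<open>The norm is constant on orbits and the truncated distance never exceeds 1, so the
  maximum of the two metrics obeys the generator constraint; the truncated part separates points.
  The radial bound will yield properness, the other one the topology.\<close>

lemma radial_le_dw:
  assumes "x \<in> X" "x' \<in> X"
  shows "\<bar>norm x - norm x'\<bar> \<le> dw x x'" "min (dist x x') 1 \<le> dw x x'"
proof -
  \<comment> \<open>An admissible metric bounds the warped metric from below.\<close>
  define \<delta> where "\<delta> x x' = max \<bar>norm x - norm x'\<bar> (min (dist x x') 1)" for x x' :: 'a
  have "Metric_space X \<delta>"
  proof
    fix x y z :: 'a
    have "min (dist x z) 1 \<le> min (dist x y) 1 + min (dist y z) 1"
      using dist_triangle[of x z y] zero_le_dist[of x y] zero_le_dist[of y z] by linarith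
    then show "\<delta> x z \<le> \<delta> x y + \<delta> y z" unfolding \<delta>_def by linarith
  next
    fix x y :: 'a show "\<delta> x y = 0 \<longleftrightarrow> x = y"
      unfolding \<delta>_def using zero_le_dist[of x y] dist_eq_0_iff[of x y]
      by (smt (verit, best))
  qed (auto simp: \<delta>_def dist_commute abs_minus_commute max_def)
  moreover have "\<delta> x x' \<le> dist x x'" for x x'
    unfolding \<delta>_def using norm_triangle_ineq3[of x x'] by (auto simp: dist_norm)
  moreover have "\<delta> x (act s x) \<le> 1" if "x \<in> X" "s \<in> S" for x s
    unfolding \<delta>_def using that S_carrier norm_act by (auto simp: subset_iff)
  ultimately have "warping_admissible X dist S act \<delta>"
    by (simp add: warping_admissible_def)
  from dw_max[OF this assms]
  show "\<bar>norm x - norm x'\<bar> \<le> dw x x'" "min (dist x x') 1 \<le> dw x x'"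
    unfolding \<delta>_def by auto
qed

text \<open>Whenever \<open>dw x x' < 1\<close>, the bounds
  \<open>min (dist x x') 1 \<le> dw x x'\<close> and \<open>dw x x' \<le> dist x x'\<close> force
  the two distances to agree. Continuity on the warped cone can therefore be checked in Euclidean
  terms.\<close>

lemma warped_topology: "W.mtopology = top_of_set X"
proof (rule topology_eq[THEN iffD2], intro allI)
  fix U
  have "(\<exists>e>0. W.mball x e \<subseteq> U) \<longleftrightarrow> (\<exists>e>0. \<forall>x'\<in>X. dist x' x < e \<longrightarrow> x' \<in> U)"
    if x: "x \<in> X" for x
  proof
    assume "\<exists>e>0. W.mball x e \<subseteq> U"
    then obtain e where e: "e > 0" "W.mball x e \<subseteq> U" by blast
    have "x' \<in> U" if "x' \<in> X" "dist x' x < e" for x'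
      using dw_le_dist[OF x that(1)] that e x by (auto simp: dist_commute subset_iff)
    then show "\<exists>e>0. \<forall>x'\<in>X. dist x' x < e \<longrightarrow> x' \<in> U" using e by blast
  next
    assume "\<exists>e>0. \<forall>x'\<in>X. dist x' x < e \<longrightarrow> x' \<in> U"
    then obtain e where e: "e > 0" "\<And>x'. x' \<in> X \<Longrightarrow> dist x' x < e \<Longrightarrow> x' \<in> U" by blast
    have "x' \<in> U" if "x' \<in> X" "dw x x' < min e 1" for x'
      using radial_le_dw(2)[OF x that(1)] that by (intro e) (auto simp: dist_commute)
    then have "W.mball x (min e 1) \<subseteq> U" by auto
    then show "\<exists>e>0. W.mball x e \<subseteq> U" using e by (metis min_less_iff_conj zero_less_one)
  qed
  then show "openin W.mtopology U \<longleftrightarrow> openin (top_of_set X) U"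
    by (auto simp: W.openin_mtopology openin_euclidean_subtopology_iff subset_iff)
qed

text \<open>The bound is the length of a word for \<open>\<gamma>\<close>, hence uniform in
  \<open>x\<close>. This keeps the supports of the final measures in warped balls of one
  radius.\<close>

lemma dw_act_bounded:
  assumes "\<gamma> \<in> carrier \<Gamma>"
  shows "\<exists>B. \<forall>x\<in>X. dw (act \<gamma> x) x \<le> B"
proof -
  have "\<gamma> \<in> generate \<Gamma> S" using assms generate_S by simp
  then show ?thesis
  proof induction
    case one
    show ?case by (intro exI[of _ 0]) (auto simp: act_one)
  next
    case (incl s)
    then show ?case using dw_gen by (intro exI[of _ 1]) (simp add: W.commute)
  next
    case (inv s)
    have "dw (act (inv\<^bsub>\<Gamma>\<^esub> s) x) x \<le> 1" if "x \<in> X" for x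
      using dw_gen[of "act (inv\<^bsub>\<Gamma>\<^esub> s) x" s] that inv S_carrier by (auto simp: act_inv subset_iff)
    then show ?case by blast
  next
    case (eng g h)
    from eng.IH obtain B C where B: "\<And>x. x \<in> X \<Longrightarrow> dw (act g x) x \<le> B"
      and C: "\<And>x. x \<in> X \<Longrightarrow> dw (act h x) x \<le> C"
      by blast
    have gh: "g \<in> carrier \<Gamma>" "h \<in> carrier \<Gamma>" using eng.hyps generate_S by auto
    have "dw (act (g \<otimes>\<^bsub>\<Gamma>\<^esub> h) x) x \<le> B + C" if "x \<in> X" for x
      using W.triangle[of "act g (act h x)" "act h x" x] B[of "act h x"] C[of x] that gh
      by (simp add: act_mult)
    then show ?case by blast
  qed
qed

text \<open>The infimum of \<open>c\<close> over all chains of cost \<open>c\<close> is an admissible metric, so it is at most the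
  warped metric.\<close>

inductive chain :: "real \<Rightarrow> 'a \<Rightarrow> 'a \<Rightarrow> bool" where
  refl: "x \<in> X \<Longrightarrow> chain 0 x x"
| move: "chain c x y \<Longrightarrow> z \<in> X \<Longrightarrow> chain (c + dist y z) x z"
| gen: "chain c x y \<Longrightarrow> s \<in> S \<Longrightarrow> chain (c + 1) x (act s y)"
| inv: "chain c x y \<Longrightarrow> s \<in> S \<Longrightarrow> chain (c + 1) x (act (inv\<^bsub>\<Gamma>\<^esub> s) y)"

text \<open>A generator step costs 1, so a chain of cost below 1 consists of Euclidean moves. This
  last clause makes the infimum of the costs separate points.\<close>

lemma chain_basic: "chain c x y \<Longrightarrow> 0 \<le> c \<and> x \<in> X \<and> y \<in> X \<and> (c < 1 \<longrightarrow> dist x y \<le> c)"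
proof (induction rule: chain.induct)
  case (move c x y z)
  then show ?case
    using dist_triangle[of x z y] zero_le_dist[of y z] by (auto simp del: zero_le_dist)
qed (use S_carrier in \<open>auto simp: subset_iff\<close>)

text \<open>Chains grow at their end, so the induction runs over the second chain; this is why it
  stands as the first premise.\<close>

lemma chain_trans: "chain c' y z \<Longrightarrow> chain c x y \<Longrightarrow> chain (c + c') x z"
proof (induction rule: chain.induct)
  case (move c' y z w)
  then show ?case using chain.move[of "c + c'" x z w] by (simp add: add.assoc)
next
  case (gen c' y z s)
  then show ?case using chain.gen[of "c + c'" x z s] by (simp add: add.assoc)
next
  case (inv c' y z s)
  then show ?case using chain.inv[of "c + c'" x z s] by (simp add: add.assoc)
qed auto

text \<open>Reversing a \<open>gen\<close> step takes an \<open>inv\<close> step and conversely.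
  This is why chains allow inverse generators, which the definition of the warped metric does not
  mention.\<close>

lemma chain_sym: "chain c x y \<Longrightarrow> chain c y x"
proof (induction rule: chain.induct)
  case (refl x)
  then show ?case by (rule chain.refl)
next
  case (move c x y z)
  then have "chain (dist z y) z y"
    using chain.move[OF chain.refl, of z y] chain_basic by auto
  then show ?case
    using chain_trans[OF move.IH, of "dist z y" z] by (simp add: dist_commute add.commute)
next
  case (gen c x y s)
  then have "y \<in> X" "s \<in> carrier \<Gamma>" using chain_basic S_carrier by auto
  then have "chain 1 (act s y) y"
    using chain.inv[OF chain.refl, of "act s y" s] gen by (auto simp: act_inv)
  then show ?case using chain_trans[OF gen.IH, of 1 "act s y"] by (simp add: add.commute)
next
  case (inv c x y s)
  then have "y \<in> X" "s \<in> carrier \<Gamma>" using chain_basic S_carrier by auto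
  then have "chain 1 (act (inv\<^bsub>\<Gamma>\<^esub> s) y) y"
    using chain.gen[OF chain.refl, of "act (inv\<^bsub>\<Gamma>\<^esub> s) y" s] inv by (auto simp: act_inv)
  then show ?case
    using chain_trans[OF inv.IH, of 1 "act (inv\<^bsub>\<Gamma>\<^esub> s) y"] by (simp add: add.commute)
qed

lemma chain_of_dw_less:
  assumes "x \<in> X" "y \<in> X" "dw x y < r"
  shows "\<exists>c<r. chain c x y"
proof -
  \<comment> \<open>The value 0 off \<open>X\<close> gives nonnegativity and symmetry there, which
    \<open>Metric_space\<close> demands of all arguments.\<close>
  define \<delta> where "\<delta> x y = (if x \<in> X \<and> y \<in> X then Inf {c. chain c x y} else 0)" for x y
  have dist: "chain (dist x y) x y" if "x \<in> X" "y \<in> X" for x y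
    using chain.move[OF chain.refl, of x y] that by simp
  have bdd: "bdd_below {c. chain c x y}" for x y
    by (rule bdd_belowI[of _ 0]) (use chain_basic in auto)
  have le: "\<delta> x y \<le> c" if "chain c x y" for c x y
    using that chain_basic[OF that] bdd unfolding \<delta>_def by (auto intro: cInf_lower)
  have less: "\<exists>c<r. chain c x y" if "x \<in> X" "y \<in> X" "\<delta> x y < r" for x y r
    using that cInf_lessD[of "{c. chain c x y}" r] dist[of x y] unfolding \<delta>_def by auto
  have "Metric_space X \<delta>"
  proof
    show nn: "0 \<le> \<delta> x y" for x y
      using less[of x y 0] chain_basic unfolding not_less[symmetric]
      by (metis \<delta>_def less_irrefl not_less)
    show "\<delta> x y = \<delta> y x" for x y
    proof -
      have "{c. chain c x y} = {c. chain c y x}" using chain_sym by blast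
      then show ?thesis by (auto simp: \<delta>_def)
    qed
    show "\<delta> x y = 0 \<longleftrightarrow> x = y" if "x \<in> X" "y \<in> X" for x y
    proof
      assume 0: "\<delta> x y = 0"
      have "dist x y \<le> e" if "e > 0" for e
        using less[of x y "min e 1"] 0 \<open>x \<in> X\<close> \<open>y \<in> X\<close> that chain_basic by force
      then have "dist x y \<le> 0" using field_le_epsilon[of "dist x y" 0] by auto
      then show "x = y" by simp
    next
      assume "x = y"
      then show "\<delta> x y = 0" using le[OF chain.refl[OF that(1)]] nn[of x y] by auto
    qed
    show "\<delta> x z \<le> \<delta> x y + \<delta> y z" if "x \<in> X" "y \<in> X" "z \<in> X" for x y z
    proof (rule field_le_epsilon)
      fix e :: real assume "e > 0"
      then have "\<delta> x y < \<delta> x y + e / 2" "\<delta> y z < \<delta> y z + e / 2" by auto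
      then obtain c c' where "c < \<delta> x y + e / 2" "chain c x y" "c' < \<delta> y z + e / 2" "chain c' y z"
        using less[OF \<open>x \<in> X\<close> \<open>y \<in> X\<close>] less[OF \<open>y \<in> X\<close> \<open>z \<in> X\<close>] by meson
      then show "\<delta> x z \<le> \<delta> x y + \<delta> y z + e"
        using le[OF chain_trans[of c' y z c x]] by linarith
    qed
  qed
  moreover have "\<delta> x (act s x) \<le> 1" if "x \<in> X" "s \<in> S" for x s
    using le[OF chain.gen[OF chain.refl]] that by auto
  ultimately have "warping_admissible X dist S act \<delta>"
    using le dist by (auto simp: warping_admissible_def)
  from dw_max[OF this assms(1,2)] show ?thesis
    using less assms by auto
qed

text \<open>The ball of radius \<open>n\<close> in the word metric of \<open>\<Gamma>\<close> for
  the generators \<open>S\<close> and their inverses.\<close>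

primrec words :: "nat \<Rightarrow> 'g set" where
  "words 0 = {\<one>\<^bsub>\<Gamma>\<^esub>}"
| "words (Suc n) = words n \<union>
     (\<Union>s\<in>S. (\<lambda>g. s \<otimes>\<^bsub>\<Gamma>\<^esub> g) ` words n \<union> (\<lambda>g. inv\<^bsub>\<Gamma>\<^esub> s \<otimes>\<^bsub>\<Gamma>\<^esub> g) ` words n)"

lemma finite_words: "finite (words n)"
  by (induction n) (auto simp: finite_S)

lemma words_carrier: "words n \<subseteq> carrier \<Gamma>"
  using S_carrier by (induction n) (auto simp: subset_iff)

lemma words_mono: "m \<le> n \<Longrightarrow> words m \<subseteq> words n"
  by (rule lift_Suc_mono_le[of words]) auto

text \<open>The generators of the chain are collected into one group element and its Euclidean moves
  into one error. A generator costs 1 and stretches the error collected so far by at most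
  \<open>L\<close>, whence the factor \<open>L powr c\<close>.\<close>

lemma chain_word:
  assumes L: "1 \<le> L" "\<And>\<gamma> x x'. \<gamma> \<in> S \<union> m_inv \<Gamma> ` S \<Longrightarrow> x \<in> X \<Longrightarrow> x' \<in> X \<Longrightarrow>
      dist (act \<gamma> x) (act \<gamma> x') \<le> L * dist x x'"
  shows "chain c x y \<Longrightarrow> \<exists>n. real n \<le> c \<and> (\<exists>\<gamma>\<in>words n. dist (act \<gamma> x) y \<le> L powr c * c)"
proof (induction rule: chain.induct)
  case (refl x)
  then show ?case by (intro exI[of _ 0]) (auto simp: act_one)
next
  case (move c x y z)
  then obtain n \<gamma> where n: "real n \<le> c" "\<gamma> \<in> words n" "dist (act \<gamma> x) y \<le> L powr c * c"
    by blast
  let ?d = "dist y z"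
  have c0: "0 \<le> c" using move.hyps chain_basic by blast
  have "dist (act \<gamma> x) z \<le> L powr c * c + 1 * ?d"
    using n(3) dist_triangle[of "act \<gamma> x" z y] by linarith
  also have "\<dots> \<le> L powr (c + ?d) * c + L powr (c + ?d) * ?d"
    using L(1) c0 by (intro add_mono mult_right_mono powr_mono ge_one_powr_ge_zero) auto
  finally have "dist (act \<gamma> x) z \<le> L powr (c + ?d) * (c + ?d)" by (simp add: algebra_simps)
  then show ?case using n by (intro exI[of _ n]) (auto intro!: add_increasing2)
next
  case (gen c x y s)
  then obtain n \<gamma> where n: "real n \<le> c" "\<gamma> \<in> words n" "dist (act \<gamma> x) y \<le> L powr c * c"
    by blast
  have *: "0 \<le> c" "x \<in> X" "y \<in> X" using gen.hyps chain_basic by blast+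
  have \<gamma>: "\<gamma> \<in> carrier \<Gamma>" "s \<in> carrier \<Gamma>" using n words_carrier gen.hyps S_carrier by auto
  have "dist (act (s \<otimes>\<^bsub>\<Gamma>\<^esub> \<gamma>) x) (act s y) \<le> L * dist (act \<gamma> x) y"
    using L(2)[of s "act \<gamma> x" y] \<gamma> * gen.hyps by (simp add: act_mult)
  also have "\<dots> \<le> L * (L powr c * c)" using n L(1) by (intro mult_left_mono) auto
  also have "\<dots> \<le> L powr (c + 1) * (c + 1)" using L(1) *(1) by (simp add: powr_add algebra_simps)
  finally have d: "dist (act (s \<otimes>\<^bsub>\<Gamma>\<^esub> \<gamma>) x) (act s y) \<le> L powr (c + 1) * (c + 1)" .
  have "s \<otimes>\<^bsub>\<Gamma>\<^esub> \<gamma> \<in> words (Suc n)" using n gen.hyps by auto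
  with d show ?case using n by (intro exI[of _ "Suc n"] conjI bexI) auto
next
  case (inv c x y s)
  then obtain n \<gamma> where n: "real n \<le> c" "\<gamma> \<in> words n" "dist (act \<gamma> x) y \<le> L powr c * c"
    by blast
  have *: "0 \<le> c" "x \<in> X" "y \<in> X" using inv.hyps chain_basic by blast+
  have \<gamma>: "\<gamma> \<in> carrier \<Gamma>" "s \<in> carrier \<Gamma>" using n words_carrier inv.hyps S_carrier by auto
  have "dist (act (inv\<^bsub>\<Gamma>\<^esub> s \<otimes>\<^bsub>\<Gamma>\<^esub> \<gamma>) x) (act (inv\<^bsub>\<Gamma>\<^esub> s) y) \<le> L * dist (act \<gamma> x) y"
    using L(2)[of "inv\<^bsub>\<Gamma>\<^esub> s" "act \<gamma> x" y] \<gamma> * inv.hyps by (simp add: act_mult)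
  also have "\<dots> \<le> L * (L powr c * c)" using n L(1) by (intro mult_left_mono) auto
  also have "\<dots> \<le> L powr (c + 1) * (c + 1)" using L(1) *(1) by (simp add: powr_add algebra_simps)
  finally have d: "dist (act (inv\<^bsub>\<Gamma>\<^esub> s \<otimes>\<^bsub>\<Gamma>\<^esub> \<gamma>) x) (act (inv\<^bsub>\<Gamma>\<^esub> s) y) \<le> L powr (c + 1) * (c + 1)" .
  have "inv\<^bsub>\<Gamma>\<^esub> s \<otimes>\<^bsub>\<Gamma>\<^esub> \<gamma> \<in> words (Suc n)" using n inv.hyps by auto
  with d show ?case using n by (intro exI[of _ "Suc n"] conjI bexI) auto
qed

text \<open>A chain of cost below \<open>r\<close> uses at most \<open>nat \<lceil>r\<rceil>\<close>
  generators, so finitely many words serve all pairs of points. For negative \<open>r\<close> the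
  claim is vacuous, and \<open>max r 0\<close> keeps the radius nonnegative.\<close>

lemma dw_less_orbit:
  "\<exists>F R. finite F \<and> F \<subseteq> carrier \<Gamma> \<and> 0 \<le> R \<and>
     (\<forall>x\<in>X. \<forall>y\<in>X. dw x y < r \<longrightarrow> (\<exists>\<gamma>\<in>F. dist (act \<gamma> x) y \<le> R))"
proof -
  obtain L where L: "1 \<le> L" "\<And>\<gamma> x x'. \<gamma> \<in> S \<union> m_inv \<Gamma> ` S \<Longrightarrow> x \<in> X \<Longrightarrow> x' \<in> X \<Longrightarrow>
      dist (act \<gamma> x) (act \<gamma> x') \<le> L * dist x x'"
  proof -
    have "finite (S \<union> m_inv \<Gamma> ` S)" "S \<union> m_inv \<Gamma> ` S \<subseteq> carrier \<Gamma>"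
      using finite_S S_carrier by auto
    from act_lipschitz[OF this] show ?thesis using that by meson
  qed
  have "\<exists>\<gamma>\<in>words (nat \<lceil>r\<rceil>). dist (act \<gamma> x) y \<le> L powr r * max r 0"
    if xy: "x \<in> X" "y \<in> X" "dw x y < r" for x y
  proof -
    obtain c where c: "c < r" "chain c x y" using chain_of_dw_less[OF xy] by blast
    obtain n \<gamma> where n: "real n \<le> c" "\<gamma> \<in> words n" "dist (act \<gamma> x) y \<le> L powr c * c"
      using chain_word[OF L c(2)] by blast
    have "0 \<le> c" using c chain_basic by blast
    then have "L powr c * c \<le> L powr r * max r 0"
      using c L(1) by (intro mult_mono powr_mono) auto
    moreover have "\<gamma> \<in> words (nat \<lceil>r\<rceil>)"
    proof -
      have "n \<le> nat \<lceil>r\<rceil>" using n(1) c(1) by linarith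
      then show ?thesis using n(2) words_mono by blast
    qed
    ultimately show ?thesis using n by force
  qed
  then show ?thesis using finite_words words_carrier
    by (intro exI[of _ "words (nat \<lceil>r\<rceil>)"] exI[of _ "L powr r * max r 0"]) auto
qed

section \<open>Bounded geometry and properness\<close>

text \<open>A warped \<open>r\<close>-ball about \<open>x\<close> is covered by the Euclidean
  \<open>R\<close>-balls about the finitely many points \<open>act \<gamma> x\<close>, and
  separation in \<open>dw\<close> implies separation in \<open>dist\<close> because
  \<open>dw\<close> is at most \<open>dist\<close>.\<close>

lemma bounded_geometry_warped: "bounded_geometry X dw"
  unfolding bounded_geometry_def
proof (rule exI[of _ "1::real"], intro conjI allI impI)
  fix r :: real
  obtain F R where F: "finite F" "F \<subseteq> carrier \<Gamma>" and
    R: "\<And>x y. x \<in> X \<Longrightarrow> y \<in> X \<Longrightarrow> dw x y < r \<Longrightarrow> \<exists>\<gamma>\<in>F. dist (act \<gamma> x) y \<le> R"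
    using dw_less_orbit by metis
  obtain s where s: "\<And>(x::'a) A. A \<subseteq> cball x R \<Longrightarrow>
      (\<And>p q. p \<in> A \<Longrightarrow> q \<in> A \<Longrightarrow> p \<noteq> q \<Longrightarrow> 1 \<le> dist p q) \<Longrightarrow> finite A \<and> card A \<le> s"
    using separated_card_bound by metis
  have "finite A \<and> card A \<le> card F * s"
    if A: "A \<subseteq> W.mball x r" "\<forall>p\<in>A. \<forall>q\<in>A. p \<noteq> q \<longrightarrow> 1 \<le> dw p q" for x A
  proof -
    have sep: "1 \<le> dist p q" if "p \<in> A" "q \<in> A" "p \<noteq> q" for p q
      using A that dw_le_dist[of p q] by fastforce
    have "finite (A \<inter> cball (act \<gamma> x) R) \<and> card (A \<inter> cball (act \<gamma> x) R) \<le> s" for \<gamma>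
      using sep by (intro s) auto
    moreover have "A = (\<Union>\<gamma>\<in>F. A \<inter> cball (act \<gamma> x) R)"
      using A(1) R by fastforce
    ultimately show ?thesis
      using F(1) card_UN_le[OF F(1), of "\<lambda>\<gamma>. A \<inter> cball (act \<gamma> x) R"]
        sum_bounded_above[of F "\<lambda>\<gamma>. card (A \<inter> cball (act \<gamma> x) R)" s]
      by (metis (no_types, lifting) finite_UN of_nat_id order_trans)
  qed
  \<comment> \<open>The added 1 makes the bound positive, as the definition asks.\<close>
  then have "finite A \<and> real (card A) \<le> real (card F * s + 1)"
    if "A \<subseteq> W.mball x r" "\<forall>p\<in>A. \<forall>q\<in>A. p \<noteq> q \<longrightarrow> 1 \<le> dw p q" for x A
    using that unfolding of_nat_le_iff by (meson le_add1 order_trans)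
  moreover have "0 < real (card F * s + 1)" unfolding of_nat_0_less_iff by simp
  ultimately show "\<exists>s>0. \<forall>x\<in>X. \<forall>A\<subseteq>W.mball x r.
      (\<forall>p\<in>A. \<forall>q\<in>A. p \<noteq> q \<longrightarrow> 1 \<le> dw p q) \<longrightarrow> finite A \<and> real (card A) \<le> s"
    by blast
qed simp

text \<open>By the radial bound a bounded set lies in a truncated cone, the continuous image of a
  compact product. Since the warped topology is the Euclidean one, a closed bounded set is closed in
  that compact set.\<close>

lemma proper_warped: "proper_metric X dw"
  unfolding proper_metric_def
proof (intro conjI allI impI, rule W.Metric_space_axioms)
  fix C assume C: "closedin W.mtopology C \<and> W.mbounded C"
  then have CX: "C \<subseteq> X" using closedin_subset by fastforce
  from C obtain x B where B: "C \<subseteq> W.mcball x B" by (auto simp: W.mbounded_def)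
  define K where "K = (\<lambda>(t, y). t *\<^sub>R y) ` ({0..norm x + B} \<times> Y)"
  have "compact K" unfolding K_def
    by (intro compact_continuous_image compact_Times compact_Y)
      (auto simp: case_prod_unfold intro!: continuous_intros)
  have KX: "K \<subseteq> X" by (auto simp: K_def intro: coneI)
  have "C \<subseteq> K"
  proof
    fix c assume c: "c \<in> C"
    then have "c \<in> X" "x \<in> X" "dw x c \<le> B" using CX B by auto
    then have "norm c \<le> norm x + B" using radial_le_dw(1)[of x c] by linarith
    moreover obtain t y where ty: "0 \<le> t" "y \<in> Y" "c = t *\<^sub>R y" using \<open>c \<in> X\<close> by (rule coneE)
    ultimately show "c \<in> K" unfolding K_def by (intro image_eqI[of _ _ "(t, y)"]) auto
  qed
  have "closedin (top_of_set X) C" using C by (simp add: warped_topology)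
  then have "closedin (top_of_set K) C"
    using KX \<open>C \<subseteq> K\<close> by (metis closedin_subset_trans)
  then have "compact C" using \<open>compact K\<close> closedin_compact by blast
  then show "compactin W.mtopology C"
    using CX by (simp add: warped_topology compactin_subtopology)
qed

end


section \<open>Almost invariant measures on the cone\<close>

text \<open>The splitting \<open>p b - p' b' = (p - p') b + p' (b - b')\<close> changes first the
  coefficients, then the vectors. It serves the group move with equal vectors and
  \<open>c = 0\<close>, and the Euclidean move with displaced balls.\<close>

lemma sum_abs_mixture_diff_le:
  fixes p p' :: "'g \<Rightarrow> real" and b b' :: "'g \<Rightarrow> 'k \<Rightarrow> real"
  assumes p': "\<And>g. g \<in> Q \<Longrightarrow> 0 \<le> p' g" "(\<Sum>g\<in>Q. p' g) \<le> 1"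
    and b: "\<And>g k. g \<in> Q \<Longrightarrow> k \<in> A \<Longrightarrow> 0 \<le> b g k" "\<And>g. g \<in> Q \<Longrightarrow> (\<Sum>k\<in>A. b g k) \<le> 1"
    and c: "\<And>g. g \<in> Q \<Longrightarrow> (\<Sum>k\<in>A. \<bar>b g k - b' g k\<bar>) \<le> c" "0 \<le> c"
  shows "(\<Sum>k\<in>A. \<bar>(\<Sum>g\<in>Q. p g * b g k) - (\<Sum>g\<in>Q. p' g * b' g k)\<bar>) \<le> (\<Sum>g\<in>Q. \<bar>p g - p' g\<bar>) + c"
proof -
  have "\<bar>(\<Sum>g\<in>Q. p g * b g k) - (\<Sum>g\<in>Q. p' g * b' g k)\<bar>
      \<le> (\<Sum>g\<in>Q. \<bar>p g - p' g\<bar> * b g k + p' g * \<bar>b g k - b' g k\<bar>)" if "k \<in> A" for k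
  proof -
    have "\<bar>p g * b g k - p' g * b' g k\<bar> \<le> \<bar>p g - p' g\<bar> * b g k + p' g * \<bar>b g k - b' g k\<bar>"
      if g: "g \<in> Q" for g
    proof -
      have "p g * b g k - p' g * b' g k = (p g - p' g) * b g k + p' g * (b g k - b' g k)"
        by (simp add: algebra_simps)
      also have "\<bar>\<dots>\<bar> \<le> \<bar>(p g - p' g) * b g k\<bar> + \<bar>p' g * (b g k - b' g k)\<bar>"
        by (rule abs_triangle_ineq)
      finally show ?thesis using p'(1)[OF g] b(1)[OF g \<open>k \<in> A\<close>] by (simp add: abs_mult)
    qed
    then show ?thesis unfolding sum_subtractf[symmetric]
      by (intro order_trans[OF sum_abs] sum_mono)
  qed
  then have "(\<Sum>k\<in>A. \<bar>(\<Sum>g\<in>Q. p g * b g k) - (\<Sum>g\<in>Q. p' g * b' g k)\<bar>)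
      \<le> (\<Sum>k\<in>A. \<Sum>g\<in>Q. \<bar>p g - p' g\<bar> * b g k + p' g * \<bar>b g k - b' g k\<bar>)"
    by (rule sum_mono)
  also have "\<dots> = (\<Sum>g\<in>Q. \<bar>p g - p' g\<bar> * (\<Sum>k\<in>A. b g k) + p' g * (\<Sum>k\<in>A. \<bar>b g k - b' g k\<bar>))"
    by (subst sum.swap) (simp add: sum.distrib sum_distrib_left)
  also have "\<dots> \<le> (\<Sum>g\<in>Q. \<bar>p g - p' g\<bar> * 1 + p' g * c)"
    using p' b c by (intro sum_mono add_mono mult_left_mono) auto
  also have "\<dots> = (\<Sum>g\<in>Q. \<bar>p g - p' g\<bar>) + (\<Sum>g\<in>Q. p' g) * c"
    by (simp add: sum.distrib sum_distrib_right)
  also have "\<dots> \<le> (\<Sum>g\<in>Q. \<bar>p g - p' g\<bar>) + 1 * c"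
    using p' c by (intro add_mono mult_right_mono) auto
  finally show ?thesis by simp
qed

text \<open>The summed difference is one continuous function on \<open>Y \<times> Y\<close> that
  vanishes on the diagonal; uniform continuity, applied at \<open>(y', y')\<close>, gives the
  claim.\<close>

lemma uniformly_continuous_family:
  fixes f :: "'a::metric_space \<Rightarrow> 'g \<Rightarrow> real"
  assumes "finite Q" "compact Y" "\<And>g. g \<in> Q \<Longrightarrow> continuous_on Y (\<lambda>y. f y g)" "0 < e"
  shows "\<exists>\<delta>>0. \<forall>y\<in>Y. \<forall>y'\<in>Y. dist y y' < \<delta> \<longrightarrow> (\<Sum>g\<in>Q. \<bar>f y g - f y' g\<bar>) \<le> e"
proof -
  define h where "h z = (\<Sum>g\<in>Q. \<bar>f (fst z) g - f (snd z) g\<bar>)" for z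
  have "continuous_on (Y \<times> Y) h" unfolding h_def
    by (intro continuous_intros continuous_on_compose2[OF assms(3)]) auto
  then have "uniformly_continuous_on (Y \<times> Y) h"
    using assms(2) by (intro compact_uniformly_continuous compact_Times)
  then obtain \<delta> where \<delta>: "\<delta> > 0" "\<And>z z'. z \<in> Y \<times> Y \<Longrightarrow> z' \<in> Y \<times> Y \<Longrightarrow> dist z' z < \<delta> \<Longrightarrow> dist (h z') (h z) < e"
    using assms(4) unfolding uniformly_continuous_on_def by metis
  have "h (y, y') \<le> e" if "y \<in> Y" "y' \<in> Y" "dist y y' < \<delta>" for y y'
    using \<delta>(2)[of "(y', y')" "(y, y')"] that by (simp add: dist_Pair_Pair h_def)
  then show ?thesis using \<delta>(1) by (auto simp: h_def)
qed

context warped_cone begin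

text \<open>The budget is four times \<open>\<epsilon> / 4\<close>: one part for the group move and
  three for the Euclidean move, namely for the kernel, the balls and the cut-off. The clause with
  \<open>c\<close> gives finite supports that are uniform on bounded parts, as weak-star continuity
  will require.\<close>

lemma almost_invariant_weights:
  assumes am: "amenable_action \<Gamma> (top_of_set Y) a" and \<epsilon>: "0 < \<epsilon>"
  obtains w :: "'a \<Rightarrow> 'a \<Rightarrow> real" and z B where
    "\<And>x k. x \<in> X \<Longrightarrow> 0 \<le> w x k" "\<And>k. continuous_on X (\<lambda>x. w x k)"
    "\<And>c. \<exists>A. finite A \<and> (\<forall>x\<in>X. norm x \<le> c \<longrightarrow> {k. w x k \<noteq> 0} \<subseteq> A \<and> (\<Sum>k\<in>A. w x k) = 1)"
    "\<And>x k. x \<in> X \<Longrightarrow> w x k \<noteq> 0 \<Longrightarrow> z k \<in> X \<and> dw x (z k) < B"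
    "\<And>x x' A. x \<in> X \<Longrightarrow> x' \<in> X \<Longrightarrow> dw x x' < r \<Longrightarrow> finite A \<Longrightarrow> (\<Sum>k\<in>A. \<bar>w x k - w x' k\<bar>) \<le> \<epsilon>"
proof -
  obtain F R where F: "finite F" "F \<subseteq> carrier \<Gamma>" and R: "0 \<le> R"
    and FR: "\<And>x y. x \<in> X \<Longrightarrow> y \<in> X \<Longrightarrow> dw x y < r \<Longrightarrow> \<exists>\<gamma>\<in>F. dist (act \<gamma> x) y \<le> R"
    using dw_less_orbit by metis
  have "0 < \<epsilon> / 4" using \<epsilon> by simp
  obtain Q p where
    Q: "finite Q" "Q \<subseteq> carrier \<Gamma>" and p0: "\<And>y g. y \<in> Y \<Longrightarrow> 0 \<le> p y g"
    and pQ: "\<And>y g. y \<in> Y \<Longrightarrow> g \<notin> Q \<Longrightarrow> p y g = 0"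
    and p1: "\<And>y. y \<in> Y \<Longrightarrow> (\<Sum>g\<in>Q. p y g) = 1" and pc: "\<And>g. continuous_on Y (\<lambda>y. p y g)"
    and pF: "\<And>\<gamma> y H. \<gamma> \<in> F \<Longrightarrow> y \<in> Y \<Longrightarrow> finite H \<Longrightarrow> H \<subseteq> carrier \<Gamma> \<Longrightarrow>
       (\<Sum>g\<in>H. \<bar>p y (g \<otimes>\<^bsub>\<Gamma>\<^esub> \<gamma>) - p (a \<gamma> y) g\<bar>) \<le> \<epsilon> / 4"
    apply (rule amenable_finite_kernel[OF is_group compact_Y _ am F \<open>0 < \<epsilon> / 4\<close>], erule (1) a_closed)
    subgoal premises prems by (rule prems(1)[OF prems(2-)])
    done
  have QG: "g \<in> carrier \<Gamma>" if "g \<in> Q" for g using that Q by auto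
  obtain L where L: "1 \<le> L" "\<And>g x x'. g \<in> Q \<Longrightarrow> x \<in> X \<Longrightarrow> x' \<in> X \<Longrightarrow>
      dist (act g x) (act g x') \<le> L * dist x x'"
    using act_lipschitz[OF Q] by blast
  obtain \<delta> where \<delta>: "0 < \<delta>" "\<And>y y'. y \<in> Y \<Longrightarrow> y' \<in> Y \<Longrightarrow> dist y y' < \<delta> \<Longrightarrow>
      (\<Sum>g\<in>Q. \<bar>p y g - p y' g\<bar>) \<le> \<epsilon> / 4"
  proof -
    have "\<exists>\<delta>>0. \<forall>y\<in>Y. \<forall>y'\<in>Y. dist y y' < \<delta> \<longrightarrow> (\<Sum>g\<in>Q. \<bar>p y g - p y' g\<bar>) \<le> \<epsilon> / 4"
      using Q(1) compact_Y pc \<open>0 < \<epsilon> / 4\<close> by (rule uniformly_continuous_family)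
    then show ?thesis using that by blast
  qed
  obtain D where D: "\<And>g x. g \<in> Q \<Longrightarrow> x \<in> X \<Longrightarrow> dw (act g x) x \<le> D"
  proof -
    have "\<forall>g\<in>Q. \<exists>B. \<forall>x\<in>X. dw (act g x) x \<le> B" using dw_act_bounded QG by blast
    then obtain b where b: "\<And>g x. g \<in> Q \<Longrightarrow> x \<in> X \<Longrightarrow> dw (act g x) x \<le> b g" by metis
    have "b g \<le> Max (b ` Q)" if "g \<in> Q" for g using that Q by simp
    then show ?thesis using b that by (meson order_trans)
  qed
  define N where "N = real DIM('a)"
  have N: "0 \<le> N" by (simp add: N_def)
  \<comment> \<open>The maps \<open>act g\<close> stretch \<open>R\<close> to at most
    \<open>L * R\<close>, and ball averages vary at rate \<open>2 * N / M\<close>; this size makes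
    their variation at most \<open>\<epsilon> / 4\<close>. The 1 keeps \<open>M\<close> positive
    when \<open>R = 0\<close>.\<close>
  define M where "M = 8 * N * L * R / \<epsilon> + 1"
  have M: "0 < M" "2 * N * (L * R) / M \<le> \<epsilon> / 4"
  proof -
    have "0 \<le> 8 * N * L * R / \<epsilon>" using N L(1) R \<epsilon> by simp
    then show "0 < M" by (simp add: M_def)
    have "2 * N * (L * R) \<le> \<epsilon> / 4 * M" using \<epsilon> by (simp add: M_def field_simps)
    then show "2 * N * (L * R) / M \<le> \<epsilon> / 4" using \<open>0 < M\<close> by (simp add: pos_divide_le_eq)
  qed
  \<comment> \<open>Beyond radius \<open>\<rho>\<close> a move by \<open>R\<close> turns the
    direction by less than \<open>\<delta>\<close>, and since \<open>R < \<rho>\<close> it cannot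
    reach the apex.\<close>
  define \<rho> where "\<rho> = 2 * R / \<delta> + R + 1"
  have \<rho>: "0 < \<rho>" "R < \<rho>" "2 * R < \<delta> * \<rho>"
  proof -
    have "0 \<le> 2 * R / \<delta>" using R \<delta>(1) by simp
    then show "0 < \<rho>" "R < \<rho>" using R by (simp_all add: \<rho>_def)
    have "\<delta> * \<rho> = 2 * R + \<delta> * (R + 1)" using \<delta>(1) by (simp add: \<rho>_def field_simps)
    moreover have "0 < \<delta> * (R + 1)" using \<delta>(1) R by simp
    ultimately show "2 * R < \<delta> * \<rho>" by linarith
  qed
  \<comment> \<open>The cut-off rises from 0 to 1 over the length \<open>h\<close>, so a move by
    \<open>R\<close> changes it by at most \<open>R / h\<close>; the factor 2 is the joint mass of
    the two families of weights between which it interpolates.\<close>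
  define h where "h = 8 * R / \<epsilon> + 1"
  have h: "0 < h" "2 * (R / h) \<le> \<epsilon> / 4"
  proof -
    have "0 \<le> 8 * R / \<epsilon>" using R \<epsilon> by simp
    then show "0 < h" by (simp add: h_def)
    have "2 * R \<le> \<epsilon> / 4 * h" using \<epsilon> by (simp add: h_def field_simps)
    then show "2 * (R / h) \<le> \<epsilon> / 4" using \<open>0 < h\<close> by (simp add: pos_divide_le_eq)
  qed
  define \<phi> where "\<phi> t = max 0 (min 1 ((t - \<rho>) / h))" for t
  have \<phi>: "0 \<le> \<phi> t" "\<phi> t \<le> 1" for t by (auto simp: \<phi>_def)
  have \<phi>0: "\<phi> t = 0" if "t \<le> \<rho>" for t
    using that h(1) divide_nonpos_pos[of "t - \<rho>" h] by (simp add: \<phi>_def)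
  have \<phi>1: "t < \<rho> + h" if "\<phi> t \<noteq> 1" for t
  proof (rule ccontr)
    assume "\<not> t < \<rho> + h"
    then have "1 \<le> (t - \<rho>) / h" using h(1) by (simp add: pos_le_divide_eq)
    then show False using that by (simp add: \<phi>_def)
  qed
  have \<phi>_lip: "\<bar>\<phi> t - \<phi> t'\<bar> \<le> \<bar>t - t'\<bar> / h" for t t'
  proof -
    have "\<bar>\<phi> t - \<phi> t'\<bar> \<le> \<bar>(t - \<rho>) / h - (t' - \<rho>) / h\<bar>" unfolding \<phi>_def by linarith
    also have "(t - \<rho>) / h - (t' - \<rho>) / h = (t - t') / h" by (simp add: diff_divide_distrib)
    finally show ?thesis using h(1) by (simp add: abs_divide)
  qed
  \<comment> \<open>At the apex \<open>x /\<^sub>R norm x\<close> is 0, which is not in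
    \<open>Y\<close>; nothing is known about the kernel there, so \<open>x = 0\<close> is treated
    apart below.\<close>
  define P where "P x k = (\<Sum>g\<in>Q. p (x /\<^sub>R norm x) g * bump M (act g x) k)" for x k
  define w where "w x k = \<phi> (norm x) * P x k + (1 - \<phi> (norm x)) * bump M 0 k" for x k
  have P0: "0 \<le> P x k" if "x \<in> X" "x \<noteq> 0" for x k
    unfolding P_def using p0[OF proj_in_Y[OF that]] bump_nonneg
    by (intro sum_nonneg mult_nonneg_nonneg) auto
  have P_sum: "(\<Sum>k\<in>A. P x k) = (\<Sum>g\<in>Q. p (x /\<^sub>R norm x) g * (\<Sum>k\<in>A. bump M (act g x) k))" for A x
    unfolding P_def by (subst sum.swap) (simp add: sum_distrib_left)
  have P_le1: "(\<Sum>k\<in>A. P x k) \<le> 1" if x: "x \<in> X" "x \<noteq> 0" and A: "finite A" for x A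
  proof -
    have "(\<Sum>k\<in>A. P x k) \<le> (\<Sum>g\<in>Q. p (x /\<^sub>R norm x) g * 1)" unfolding P_sum
      using p0[OF proj_in_Y[OF x]] sum_bump_le_1[OF A M(1)] by (intro sum_mono mult_left_mono) auto
    then show ?thesis using p1[OF proj_in_Y[OF x]] by simp
  qed
  have w_small: "w x k = bump M 0 k" if "norm x \<le> \<rho>" for x k
    using \<phi>0[OF that] by (simp add: w_def)
  have w0: "0 \<le> w x k" if "x \<in> X" for x k
  proof (cases "x = 0")
    case True
    then show ?thesis using w_small[of 0 k] \<rho> bump_nonneg by simp
  next
    case False
    then show ?thesis using P0[OF that] \<phi> bump_nonneg[of M 0 k] by (simp add: w_def)
  qed
  have w_cont: "continuous_on X (\<lambda>x. w x k)" for k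
  proof -
    let ?U = "X \<inter> ball 0 \<rho>" and ?V = "X \<inter> - {0}"
    have X: "?U \<union> ?V = X" using \<rho> by (auto simp: zero_in_cone)
    \<comment> \<open>\<open>P\<close> need not be continuous at the apex, but there the cut-off \<open>\<phi>\<close> vanishes.\<close>
    have "continuous_on (?U \<union> ?V) (\<lambda>x. w x k)"
    proof (rule continuous_on_Un_local_open)
      show "openin (top_of_set (?U \<union> ?V)) ?U" "openin (top_of_set (?U \<union> ?V)) ?V"
        unfolding X by (auto intro: openin_open_Int)
      have "continuous_on ?U (\<lambda>x. bump M (0::'a) k)" by simp
      then show "continuous_on ?U (\<lambda>x. w x k)"
        by (rule continuous_on_cong[THEN iffD1, rotated -1]) (auto simp: w_small)
      have "continuous_on ?V (\<lambda>x. \<phi> (norm x))"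
        unfolding \<phi>_def using h(1) by (intro continuous_intros) auto
      moreover have "continuous_on ?V (\<lambda>x. P x k)" unfolding P_def
      proof (intro continuous_on_sum continuous_on_mult)
        fix g assume g: "g \<in> Q"
        show "continuous_on ?V (\<lambda>x. p (x /\<^sub>R norm x) g)"
          by (rule continuous_on_compose2[OF pc]) (auto intro!: continuous_intros proj_in_Y)
        show "continuous_on ?V (\<lambda>x. bump M (act g x) k)"
          by (rule continuous_on_compose2[OF continuous_bump[OF M(1)]])
            (use continuous_on_subset[OF continuous_act[OF QG[OF g]], of ?V] in auto)
      qed
      ultimately show "continuous_on ?V (\<lambda>x. w x k)"
        unfolding w_def by (intro continuous_intros)
    qed
    then show ?thesis unfolding X .
  qed
  have w_fin: "\<exists>A. finite A \<and> (\<forall>x\<in>X. norm x \<le> c \<longrightarrow> {k. w x k \<noteq> 0} \<subseteq> A \<and> (\<Sum>k\<in>A. w x k) = 1)" for c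
  proof -
    \<comment> \<open>The group preserves norms, so all centres of balls, \<open>0\<close> and
      \<open>act g x\<close>, have norm at most \<open>c\<close>.\<close>
    define A :: "'a set" where "A = cell ` cball 0 (c + M)"
    have A: "finite A" unfolding A_def by (rule finite_cell_image) simp
    have sub: "cell ` ball v M \<subseteq> A" if "norm v \<le> c" for v :: 'a
      unfolding A_def using that
      by (intro image_mono) (auto simp: dist_norm, smt (verit) norm_triangle_sub norm_minus_commute)
    have "{k. w x k \<noteq> 0} \<subseteq> A \<and> (\<Sum>k\<in>A. w x k) = 1" if x: "x \<in> X" "norm x \<le> c" for x
    proof -
      have z: "cell ` ball 0 M \<subseteq> A" using order_trans[OF norm_ge_zero x(2)] by (intro sub) simp
      have b0: "(\<Sum>k\<in>A. bump M 0 k) = 1" by (rule sum_bump[OF A z M(1)])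
      have bz: "k \<in> A" if "bump M 0 k \<noteq> 0" for k using bump_nonzero_cell[OF that] z by auto
      show ?thesis
      proof (cases "x = 0")
        case True
        then show ?thesis using b0 bz w_small[of 0] \<rho>(1) by auto
      next
        case False
        note y = proj_in_Y[OF x(1) False]
        have sg: "cell ` ball (act g x) M \<subseteq> A" if "g \<in> Q" for g
          using that x norm_act[OF QG[OF that] x(1)] by (intro sub) simp
        have "(\<Sum>k\<in>A. P x k) = 1"
          unfolding P_sum using p1[OF y] sum_bump[OF A sg M(1)] by simp
        then have "(\<Sum>k\<in>A. w x k) = 1"
          using b0 by (simp add: w_def sum.distrib flip: sum_distrib_left)
        moreover have "k \<in> A" if "w x k \<noteq> 0" for k
        proof (rule ccontr)
          assume k: "k \<notin> A"
          then have "bump M (act g x) k = 0" if "g \<in> Q" for g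
            using bump_nonzero_cell[of M "act g x" k] sg[OF that] by blast
          then have "P x k = 0" by (simp add: P_def)
          then show False using that bz k by (auto simp: w_def)
        qed
        ultimately show ?thesis by blast
      qed
    qed
    then show ?thesis using A by blast
  qed
  \<comment> \<open>The choice depends on \<open>k\<close> alone. If no cone point gives
    \<open>k\<close> a nonzero \<open>bump\<close>, the value is arbitrary, but such a
    \<open>k\<close> never has positive weight.\<close>
  define z where "z k = (SOME v. v \<in> X \<and> bump M v k \<noteq> 0)" for k
  \<comment> \<open>\<open>D\<close> bounds the way from \<open>x\<close> to a centre
    \<open>act g x\<close>, and \<open>\<rho> + h\<close> the way to the centre 0 where the constant
    weights are active; \<open>2 * (M + N)\<close> leads from the centre via \<open>k\<close> to
    \<open>z k\<close>, and 1 makes the inequality strict.\<close>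
  define B where "B = max D (\<rho> + h) + 2 * (M + N) + 1"
  have zk: "z k \<in> X \<and> dw v (z k) \<le> 2 * (M + N)" if "v \<in> X" "bump M v k \<noteq> 0" for v k
  proof -
    have zX: "z k \<in> X \<and> bump M (z k) k \<noteq> 0"
      unfolding z_def by (rule someI[of _ v]) (use that in simp)
    have "dist v (z k) \<le> dist v k + dist (z k) k" by (rule dist_triangle2)
    also have "\<dots> \<le> 2 * (M + N)"
      using bump_nonzero_dist[OF that(2)] bump_nonzero_dist[of M "z k" k] zX by (simp add: N_def)
    finally show ?thesis using dw_le_dist[of v "z k"] that zX by auto
  qed
  have w_supp: "z k \<in> X \<and> dw x (z k) < B" if x: "x \<in> X" and k: "w x k \<noteq> 0" for x k
  proof -
    have "\<exists>v\<in>X. bump M v k \<noteq> 0 \<and> dw x v \<le> max D (\<rho> + h)"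
    proof (cases "(1 - \<phi> (norm x)) * bump M 0 k = 0")
      case True
      then have "P x k \<noteq> 0" using k by (auto simp: w_def)
      then obtain g where g: "g \<in> Q" "bump M (act g x) k \<noteq> 0"
        unfolding P_def by (metis (no_types, lifting) mult_zero_right sum.neutral)
      then show ?thesis using D[OF g(1) x] QG[OF g(1)] x
        by (intro bexI[of _ "act g x"]) (auto simp: W.commute)
    next
      case False
      then have "norm x < \<rho> + h" "bump M 0 k \<noteq> 0" using \<phi>1[of "norm x"] by auto
      then show ?thesis using dw_le_dist[OF x zero_in_cone[OF x]] zero_in_cone[OF x]
        by (intro bexI[of _ 0]) auto
    qed
    then obtain v where v: "v \<in> X" "bump M v k \<noteq> 0" "dw x v \<le> max D (\<rho> + h)" by blast
    then show ?thesis using zk[OF v(1,2)] W.triangle[OF x v(1), of "z k"] by (auto simp: B_def)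
  qed
  have w_act: "(\<Sum>k\<in>A. \<bar>w x k - w (act \<gamma> x) k\<bar>) \<le> \<epsilon> / 4"
    if x: "x \<in> X" and \<gamma>: "\<gamma> \<in> F" and A: "finite A" for x \<gamma> A
  proof (cases "x = 0")
    case True
    then have "act \<gamma> x = x" by (simp add: cone_action_def)
    then show ?thesis using \<epsilon> by simp
  next
    case False
    have \<gamma>G: "\<gamma> \<in> carrier \<Gamma>" using \<gamma> F by auto
    let ?y = "x /\<^sub>R norm x"
    have y: "?y \<in> Y" by (rule proj_in_Y[OF x False])
    have n: "norm (act \<gamma> x) = norm x" by (rule norm_act[OF \<gamma>G x])
    have ay: "act \<gamma> x /\<^sub>R norm (act \<gamma> x) = a \<gamma> ?y"
      unfolding n using False by (simp add: cone_action_def)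
    have ayY: "a \<gamma> ?y \<in> Y" using \<gamma>G y by simp
    \<comment> \<open>\<open>H\<close> contains the supports of both families of coefficients, of
      \<open>p (a \<gamma> ?y)\<close> and of \<open>p ?y\<close> translated by
      \<open>\<gamma>\<close>.\<close>
    define H where "H = Q \<union> (\<lambda>g. g \<otimes>\<^bsub>\<Gamma>\<^esub> inv\<^bsub>\<Gamma>\<^esub> \<gamma>) ` Q"
    have H: "finite H" "H \<subseteq> carrier \<Gamma>" using Q \<gamma>G by (auto simp: H_def)
    have HG: "g \<in> carrier \<Gamma>" if "g \<in> H" for g using that H by auto
    \<comment> \<open>This substitution puts the balls at the same centres as in
      \<open>P (act \<gamma> x)\<close>. Then only the coefficients differ, and amenability controls
      these.\<close>
    have Px: "P x k = (\<Sum>g\<in>H. p ?y (g \<otimes>\<^bsub>\<Gamma>\<^esub> \<gamma>) * bump M (act (g \<otimes>\<^bsub>\<Gamma>\<^esub> \<gamma>) x) k)" for k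
    proof -
      have "(\<Sum>g\<in>H. p ?y (g \<otimes>\<^bsub>\<Gamma>\<^esub> \<gamma>) * bump M (act (g \<otimes>\<^bsub>\<Gamma>\<^esub> \<gamma>) x) k)
          = (\<Sum>g\<in>(\<lambda>g. g \<otimes>\<^bsub>\<Gamma>\<^esub> \<gamma>) ` H. p ?y g * bump M (act g x) k)"
        using HG \<gamma>G by (subst sum.reindex) (auto simp: inj_on_def)
      also have "\<dots> = P x k" unfolding P_def
      proof (rule sum.mono_neutral_right)
        show "Q \<subseteq> (\<lambda>g. g \<otimes>\<^bsub>\<Gamma>\<^esub> \<gamma>) ` H"
        proof
          fix g assume g: "g \<in> Q"
          then have "g = (g \<otimes>\<^bsub>\<Gamma>\<^esub> inv\<^bsub>\<Gamma>\<^esub> \<gamma>) \<otimes>\<^bsub>\<Gamma>\<^esub> \<gamma>" using QG \<gamma>G by (simp add: m_assoc)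
          moreover have "g \<otimes>\<^bsub>\<Gamma>\<^esub> inv\<^bsub>\<Gamma>\<^esub> \<gamma> \<in> H" using g by (simp add: H_def)
          ultimately show "g \<in> (\<lambda>g. g \<otimes>\<^bsub>\<Gamma>\<^esub> \<gamma>) ` H" by (rule image_eqI)
        qed
      qed (use H pQ[OF y] in auto)
      finally show ?thesis by simp
    qed
    have Pg: "P (act \<gamma> x) k = (\<Sum>g\<in>H. p (a \<gamma> ?y) g * bump M (act (g \<otimes>\<^bsub>\<Gamma>\<^esub> \<gamma>) x) k)" for k
    proof -
      have "P (act \<gamma> x) k = (\<Sum>g\<in>Q. p (a \<gamma> ?y) g * bump M (act (g \<otimes>\<^bsub>\<Gamma>\<^esub> \<gamma>) x) k)"
        unfolding P_def ay using QG \<gamma>G x by (intro sum.cong) (simp_all add: act_mult)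
      also have "\<dots> = (\<Sum>g\<in>H. p (a \<gamma> ?y) g * bump M (act (g \<otimes>\<^bsub>\<Gamma>\<^esub> \<gamma>) x) k)"
        using H pQ[OF ayY] by (intro sum.mono_neutral_left) (auto simp: H_def)
      finally show ?thesis .
    qed
    have "(\<Sum>g\<in>H. p (a \<gamma> ?y) g) = (\<Sum>g\<in>Q. p (a \<gamma> ?y) g)"
      using H pQ[OF ayY] by (intro sum.mono_neutral_right) (auto simp: H_def)
    then have "(\<Sum>k\<in>A. \<bar>P x k - P (act \<gamma> x) k\<bar>) \<le> (\<Sum>g\<in>H. \<bar>p ?y (g \<otimes>\<^bsub>\<Gamma>\<^esub> \<gamma>) - p (a \<gamma> ?y) g\<bar>) + 0"
      unfolding Px Pg using p0[OF ayY] p1[OF ayY] sum_bump_le_1[OF A M(1)] bump_nonneg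
      by (intro sum_abs_mixture_diff_le) auto
    also have "\<dots> \<le> \<epsilon> / 4" using pF[OF \<gamma> y H] by simp
    finally have *: "(\<Sum>k\<in>A. \<bar>P x k - P (act \<gamma> x) k\<bar>) \<le> \<epsilon> / 4" .
    have "\<bar>w x k - w (act \<gamma> x) k\<bar> = \<phi> (norm x) * \<bar>P x k - P (act \<gamma> x) k\<bar>" for k
      using \<phi>(1)[of "norm x"] by (simp add: w_def n abs_mult flip: right_diff_distrib)
    then have "(\<Sum>k\<in>A. \<bar>w x k - w (act \<gamma> x) k\<bar>) = \<phi> (norm x) * (\<Sum>k\<in>A. \<bar>P x k - P (act \<gamma> x) k\<bar>)"
      by (simp add: sum_distrib_left)
    also have "\<dots> \<le> 1 * (\<epsilon> / 4)" using \<phi> * by (intro mult_mono) (auto intro: sum_nonneg)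
    finally show ?thesis by simp
  qed
  have w_dist1: "(\<Sum>k\<in>A. \<bar>w x k - w x' k\<bar>) \<le> 3 * \<epsilon> / 4"
    if x: "x \<in> X" "x' \<in> X" "dist x x' \<le> R" "\<rho> < norm x" and A: "finite A" for x x' A
  proof -
    have n: "\<bar>norm x - norm x'\<bar> \<le> R"
      using norm_triangle_ineq3[of x x'] x(3) by (simp add: dist_norm)
    have x0: "x \<noteq> 0" "x' \<noteq> 0" using x(4) \<rho> n by auto
    let ?y = "x /\<^sub>R norm x" and ?y' = "x' /\<^sub>R norm x'"
    have y: "?y \<in> Y" "?y' \<in> Y" using x x0 proj_in_Y by auto
    have "norm x * dist ?y ?y' \<le> 2 * dist x x'"
      using norm_scaleR_diff_le[of ?y ?y' "norm x" "norm x'"] x0 by simp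
    also have "\<dots> \<le> 2 * R" using x(3) by simp
    also have "\<dots> < \<delta> * \<rho>" by (rule \<rho>)
    also have "\<dots> \<le> norm x * \<delta>" using x(4) \<delta>(1) by (simp add: mult.commute)
    finally have "dist ?y ?y' < \<delta>" using x0 by simp
    then have yy: "(\<Sum>g\<in>Q. \<bar>p ?y g - p ?y' g\<bar>) \<le> \<epsilon> / 4" using \<delta>(2) y by blast
    have "(\<Sum>k\<in>A. \<bar>P x k - P x' k\<bar>) \<le> (\<Sum>g\<in>Q. \<bar>p ?y g - p ?y' g\<bar>) + \<epsilon> / 4"
      unfolding P_def
    proof (rule sum_abs_mixture_diff_le)
      fix g assume g: "g \<in> Q"
      have "dist (act g x) (act g x') \<le> L * R"
        using L(2)[OF g x(1,2)] x(3) L(1) by (meson mult_left_mono order_trans zero_le_one)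
      then have "2 * N * dist (act g x) (act g x') / M \<le> 2 * N * (L * R) / M"
        using N M(1) by (intro divide_right_mono mult_left_mono) auto
      then show "(\<Sum>k\<in>A. \<bar>bump M (act g x) k - bump M (act g x') k\<bar>) \<le> \<epsilon> / 4"
        using sum_bump_diff_le[OF A M(1), of "act g x" "act g x'"] M(2) by (simp add: N_def)
    qed (use p0 p1 y \<epsilon> bump_nonneg sum_bump_le_1[OF A M(1)] in auto)
    with yy have PP: "(\<Sum>k\<in>A. \<bar>P x k - P x' k\<bar>) \<le> \<epsilon> / 2" by simp
    have "\<bar>w x k - w x' k\<bar> \<le> \<bar>P x k - P x' k\<bar> + R / h * (P x' k + bump M 0 k)" for k
    proof -
      \<comment> \<open>The kernel term keeps the factor \<open>\<phi> (norm x)\<close>, which is at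
        most 1; the change of the cut-off multiplies a difference of two weights at
        \<open>x'\<close>, whose sum over \<open>k\<close> has mass at most 2.\<close>
      have "w x k - w x' k = \<phi> (norm x) * (P x k - P x' k)
          + (\<phi> (norm x) - \<phi> (norm x')) * (P x' k - bump M 0 k)"
        by (simp add: w_def algebra_simps)
      also have "\<bar>\<dots>\<bar> \<le> \<phi> (norm x) * \<bar>P x k - P x' k\<bar>
          + \<bar>\<phi> (norm x) - \<phi> (norm x')\<bar> * \<bar>P x' k - bump M 0 k\<bar>"
        using abs_triangle_ineq \<phi>(1) by (metis abs_mult abs_of_nonneg)
      also have "\<dots> \<le> 1 * \<bar>P x k - P x' k\<bar> + R / h * (P x' k + bump M 0 k)"
      proof (intro add_mono mult_mono)
        show "\<bar>\<phi> (norm x) - \<phi> (norm x')\<bar> \<le> R / h"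
          using \<phi>_lip[of "norm x" "norm x'"] n h(1) by (meson divide_right_mono less_imp_le order_trans)
        show "\<bar>P x' k - bump M 0 k\<bar> \<le> P x' k + bump M 0 k"
          using P0[OF x(2) x0(2), of k] bump_nonneg[of M 0 k] by linarith
      qed (use \<phi> R h in auto)
      finally show ?thesis by simp
    qed
    then have "(\<Sum>k\<in>A. \<bar>w x k - w x' k\<bar>) \<le> (\<Sum>k\<in>A. \<bar>P x k - P x' k\<bar> + R / h * (P x' k + bump M 0 k))"
      by (intro sum_mono)
    also have "\<dots> = (\<Sum>k\<in>A. \<bar>P x k - P x' k\<bar>) + R / h * ((\<Sum>k\<in>A. P x' k) + (\<Sum>k\<in>A. bump M 0 k))"
      unfolding sum.distrib sum_distrib_left[symmetric] ..
    also have "\<dots> \<le> \<epsilon> / 2 + R / h * (1 + 1)"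
      using PP R h(1) P_le1[OF x(2) x0(2) A] sum_bump_le_1[OF A M(1), of "0::'a"]
      by (intro add_mono mult_left_mono) auto
    also have "\<dots> \<le> 3 * \<epsilon> / 4" using h(2) by simp
    finally show ?thesis .
  qed
  have w_dist: "(\<Sum>k\<in>A. \<bar>w x k - w x' k\<bar>) \<le> 3 * \<epsilon> / 4"
    if x: "x \<in> X" "x' \<in> X" "dist x x' \<le> R" and A: "finite A" for x x' A
  proof -
    \<comment> \<open>\<open>w_dist1\<close> asks for one endpoint outside radius
      \<open>\<rho>\<close>; with both inside, the weights coincide.\<close>
    consider "\<rho> < norm x" | "\<rho> < norm x'" | "norm x \<le> \<rho>" "norm x' \<le> \<rho>" by linarith
    then show ?thesis
    proof cases
      case 1
      then show ?thesis using w_dist1 x A by blast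
    next
      case 2
      then show ?thesis using w_dist1[of x' x A] x A by (simp add: dist_commute abs_minus_commute)
    next
      case 3
      then show ?thesis using w_small \<epsilon> by simp
    qed
  qed
  have "(\<Sum>k\<in>A. \<bar>w x k - w x' k\<bar>) \<le> \<epsilon>"
    if x: "x \<in> X" "x' \<in> X" "dw x x' < r" and A: "finite A" for x x' A
  proof -
    obtain \<gamma> where \<gamma>: "\<gamma> \<in> F" "dist (act \<gamma> x) x' \<le> R" using FR[OF x] by blast
    then have X: "act \<gamma> x \<in> X" using F x by auto
    have "(\<Sum>k\<in>A. \<bar>w x k - w x' k\<bar>) \<le> (\<Sum>k\<in>A. \<bar>w x k - w (act \<gamma> x) k\<bar> + \<bar>w (act \<gamma> x) k - w x' k\<bar>)"
      by (intro sum_mono) linarith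
    also have "\<dots> \<le> \<epsilon> / 4 + 3 * \<epsilon> / 4"
      unfolding sum.distrib by (intro add_mono w_act w_dist) (use x X A \<gamma> in auto)
    finally show ?thesis by simp
  qed
  from that[OF w0 w_cont w_fin w_supp this] show thesis .
qed

lemma almost_invariant_measures:
  assumes am: "amenable_action \<Gamma> (top_of_set Y) a" and \<epsilon>: "0 < \<epsilon>"
  shows "\<exists>f. weak_star_continuous W.mtopology W.mtopology f \<and>
     (\<exists>B. \<forall>x\<in>X. measure (f x) (W.mball x B) = 1) \<and>
     (\<forall>x\<in>X. \<forall>x'\<in>X. dw x x' < r \<longrightarrow> Prob_dist W.mtopology (f x) (f x') \<le> \<epsilon>)"
proof -
  obtain w :: "'a \<Rightarrow> 'a \<Rightarrow> real" and z B where
    w0: "\<And>x k. x \<in> X \<Longrightarrow> 0 \<le> w x k" and w_cont: "\<And>k. continuous_on X (\<lambda>x. w x k)"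
    and w_fin: "\<And>c. \<exists>A. finite A \<and> (\<forall>x\<in>X. norm x \<le> c \<longrightarrow> {k. w x k \<noteq> 0} \<subseteq> A \<and> (\<Sum>k\<in>A. w x k) = 1)"
    and w_supp: "\<And>x k. x \<in> X \<Longrightarrow> w x k \<noteq> 0 \<Longrightarrow> z k \<in> X \<and> dw x (z k) < B"
    and w_diff: "\<And>x x' A. x \<in> X \<Longrightarrow> x' \<in> X \<Longrightarrow> dw x x' < r \<Longrightarrow> finite A \<Longrightarrow> (\<Sum>k\<in>A. \<bar>w x k - w x' k\<bar>) \<le> \<epsilon>"
    apply (rule almost_invariant_weights[OF am \<epsilon>, of r])
    subgoal premises prems by (rule prems(1)[OF prems(2-)])
    done
  let ?T = W.mtopology
  define A where "A x = {k. w x k \<noteq> 0}" for x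
  have A: "finite (A x)" "(\<Sum>k\<in>A x. w x k) = 1" if x: "x \<in> X" for x
  proof -
    obtain A' where A': "finite A'" "A x \<subseteq> A'" "(\<Sum>k\<in>A'. w x k) = 1"
      using w_fin[of "norm x"] x by (auto simp: A_def)
    then show "finite (A x)" by (auto intro: finite_subset)
    have "(\<Sum>k\<in>A'. w x k) = (\<Sum>k\<in>A x. w x k)"
      using A' by (intro sum.mono_neutral_right) (auto simp: A_def)
    then show "(\<Sum>k\<in>A x. w x k) = 1" using A' by simp
  qed
  have zA: "z ` A x \<subseteq> X" if "x \<in> X" for x using w_supp[OF that] by (auto simp: A_def)
  have t1: "t1_space ?T"
    using W.Hausdorff_space_mtopology Hausdorff_imp_t1_space by blast
  define f where "f x = dirac_sum ?T (A x) (w x) z" for x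
  have "weak_star_continuous ?T ?T f" unfolding f_def
  proof (rule weak_star_continuous_dirac_sum[OF t1 _ _ _ _ t1])
    fix x assume x: "x \<in> topspace ?T"
    \<comment> \<open>Within warped distance 1 the norm grows by at most 1.\<close>
    obtain A' where A': "finite A'" "\<And>x'. x' \<in> X \<Longrightarrow> norm x' \<le> norm x + 1 \<Longrightarrow> A x' \<subseteq> A'"
      using w_fin[of "norm x + 1"] by (auto simp: A_def)
    have "A x' \<subseteq> A'" if "x' \<in> W.mball x 1" for x'
      using that radial_le_dw(1)[of x x'] by (intro A'(2)) auto
    then show "\<exists>U B. openin ?T U \<and> x \<in> U \<and> finite B \<and> (\<forall>x'\<in>U. A x' \<subseteq> B \<and> (\<forall>k\<in>B - A x'. w x' k = 0))"
      using A'(1) x by (intro exI[of _ "W.mball x 1"] exI[of _ A']) (auto simp: A_def)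
  qed (use A w0 zA w_cont in \<open>auto simp: warped_topology\<close>)
  moreover have "measure (f x) (W.mball x B) = 1" if "x \<in> X" for x
    unfolding f_def using A[OF that] w0[OF that] zA[OF that] w_supp[OF that] that
    by (intro measure_dirac_sum_eq_1) auto
  moreover have "Prob_dist ?T (f x) (f x') \<le> \<epsilon>" if x: "x \<in> X" "x' \<in> X" "dw x x' < r" for x x'
  proof -
    have fin: "finite (A x \<union> A x')" using A(1) x by simp
    \<comment> \<open>Labels of weight zero carry no mass, so both measures can be written over one
      label set, where the l1 bound applies.\<close>
    have extend: "f v = dirac_sum ?T (A x \<union> A x') (w v) z"
      if v: "v \<in> {x, x'}" for v
    proof (rule measure_eqI)
      fix E assume "E \<in> sets (f v)"
      then have E: "E \<in> sigma_sets (topspace ?T) {U. openin ?T U}" by (simp add: f_def)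
      have "(\<Sum>k\<in>{k \<in> A v. z k \<in> E}. w v k) = (\<Sum>k\<in>{k \<in> A x \<union> A x'. z k \<in> E}. w v k)"
        using v fin by (intro sum.mono_neutral_left) (auto simp: A_def intro: finite_subset[of _ "A x \<union> A x'"])
      then show "emeasure (f v) E = emeasure (dirac_sum ?T (A x \<union> A x') (w v) z) E"
        unfolding f_def using v x A(1) zA w0 E
        by (subst (1 2) emeasure_dirac_sum) (auto simp del: Collect_disj_eq)
    qed (simp add: f_def)
    have "Prob_dist ?T (f x) (f x') \<le> (\<Sum>k\<in>A x \<union> A x'. \<bar>w x k - w x' k\<bar>)"
      unfolding extend[of x, simplified] extend[of x', simplified] using zA w0 x
      by (intro Prob_dist_dirac_sum_le[OF fin]) (auto simp: image_Un)
    also have "\<dots> \<le> \<epsilon>" using w_diff x A(1) by auto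
    finally show ?thesis .
  qed
  ultimately show ?thesis by blast
qed

text \<open>The \<open>n\<close>-th map is almost invariant at scale \<open>n\<close> with error
  \<open>1 / (n + 1)\<close>, so for each \<open>s\<close> all \<open>n \<ge> s\<close> obey one
  null sequence.\<close>

lemma property_A_warped:
  assumes "amenable_action \<Gamma> (top_of_set Y) a"
  shows "property_A X dw"
proof -
  let ?T = W.mtopology
  have "\<exists>f. weak_star_continuous ?T ?T f \<and>
     (\<exists>B. \<forall>x\<in>X. measure (f x) (W.mball x B) = 1) \<and>
     (\<forall>x\<in>X. \<forall>x'\<in>X. dw x x' < real n \<longrightarrow> Prob_dist ?T (f x) (f x') \<le> inverse (real (Suc n)))" for n
    using assms by (rule almost_invariant_measures) simp
  then obtain f where wc: "\<And>n. weak_star_continuous ?T ?T (f n)"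
    and supp: "\<And>n. \<exists>B. \<forall>x\<in>X. measure (f n x) (W.mball x B) = 1"
    and diff: "\<And>n x x'. x \<in> X \<Longrightarrow> x' \<in> X \<Longrightarrow> dw x x' < real n \<Longrightarrow>
        Prob_dist ?T (f n x) (f n x') \<le> inverse (real (Suc n))"
    by metis
  have nn: "0 \<le> Prob_dist ?T (f n x) (f n x')" if "x \<in> X" "x' \<in> X" for n x x'
    using wc[of n] that by (intro Prob_dist_nonneg ProbD) (auto simp: weak_star_continuous_def)
  have "uniform_limit {(x, y). x \<in> X \<and> y \<in> X \<and> dw x y < s}
      (\<lambda>n (x, y). Prob_dist ?T (f n x) (f n y)) (\<lambda>_. 0) sequentially" for s
  proof (rule uniform_limitI)
    fix e :: real assume "0 < e"
    then have "\<forall>\<^sub>F n in sequentially. inverse (real (Suc n)) < e"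
      using order_tendstoD(2)[OF LIMSEQ_inverse_real_of_nat] by blast
    moreover have "\<forall>\<^sub>F n in sequentially. s \<le> real n"
      using eventually_ge_at_top[of "nat \<lceil>s\<rceil>"] by eventually_elim linarith
    ultimately show "\<forall>\<^sub>F n in sequentially. \<forall>v\<in>{(x, y). x \<in> X \<and> y \<in> X \<and> dw x y < s}.
        dist (case v of (x, y) \<Rightarrow> Prob_dist ?T (f n x) (f n y)) 0 < e"
    proof eventually_elim
      case (elim n)
      have "dist (Prob_dist ?T (f n x) (f n y)) 0 < e" if "x \<in> X" "y \<in> X" "dw x y < s" for x y
        using nn[of x y n] diff[of x y n] that elim by simp
      then show ?case by auto
    qed
  qed
  then show ?thesis unfolding property_A_def Let_def
    using proper_warped bounded_geometry_warped wc supp by blast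
qed

end

text \<open>The standard simplex lies in the hyperplane where the coordinates sum to 1, so it misses
  0 and the radial projection is continuous on it.\<close>

lemma spherical_finite_complex_compact:
  assumes "spherical_finite_complex (Y :: 'a::euclidean_space set)"
  shows "compact Y" "Y \<subseteq> sphere 0 1"
proof -
  obtain K where K: "simplicial_complex K" "\<And>\<sigma>. \<sigma> \<in> K \<Longrightarrow> \<sigma> face_of (convex hull (Basis :: 'a set))"
    and Y: "Y = (\<lambda>x. x /\<^sub>R norm x) ` \<Union>K"
    using assms by (auto simp: spherical_finite_complex_def)
  have sub: "\<Union>K \<subseteq> convex hull Basis" using face_of_imp_subset[OF K(2)] by blast
  have "\<sigma> \<in> K \<Longrightarrow> compact \<sigma>" for \<sigma>
    using face_of_imp_compact[OF convex_convex_hull _ K(2)] finite_imp_compact_convex_hull[OF finite_Basis]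
    by blast
  then have "compact (\<Union>K)" using K(1) by (intro compact_Union) (auto simp: simplicial_complex_def)
  have nz: "x \<noteq> 0" if "x \<in> \<Union>K" for x
  proof -
    have "convex hull Basis \<subseteq> {v::'a. (\<Sum>b\<in>Basis. v \<bullet> b) = 1}"
    proof (rule hull_minimal)
      show "Basis \<subseteq> {v::'a. (\<Sum>b\<in>Basis. v \<bullet> b) = 1}"
        by (auto simp: inner_Basis if_distrib sum.delta cong: if_cong)
      show "convex {v::'a. (\<Sum>b\<in>Basis. v \<bullet> b) = 1}"
        by (auto simp: convex_def inner_add_left sum.distrib simp flip: sum_distrib_left)
    qed
    then have "x \<in> {v. (\<Sum>b\<in>Basis. v \<bullet> b) = 1}" using sub that by blast
    then show ?thesis by auto
  qed
  show "compact Y" unfolding Y using \<open>compact (\<Union>K)\<close> nz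
    by (intro compact_continuous_image continuous_intros) auto
  show "Y \<subseteq> sphere 0 1"
  proof
    fix y assume "y \<in> Y"
    then obtain x where "x \<in> \<Union>K" "y = x /\<^sub>R norm x" unfolding Y by blast
    then show "y \<in> sphere 0 1" using nz[of x] by simp
  qed
qed

theorem theorem3p4:
  fixes Y :: "'a::euclidean_space set"
    and \<Gamma> :: "('g, 'm) monoid_scheme"
    and a :: "'g \<Rightarrow> 'a \<Rightarrow> 'a"
    and S :: "'g set"
  assumes "spherical_compact_manifold Y \<or> spherical_finite_complex Y"
    and "group_action \<Gamma> Y a"
    and "finite S" and "S \<subseteq> carrier \<Gamma>" and "generate \<Gamma> S = carrier \<Gamma>"
    and "\<forall>\<gamma>\<in>carrier \<Gamma>. lipschitz_homeomorphism_on Y (a \<gamma>)"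
    and "amenable_action \<Gamma> (top_of_set Y) a"
  shows "property_A (open_cone Y) (warped_metric (open_cone Y) dist S (cone_action a))"
proof -
  have "compact Y" "Y \<subseteq> sphere 0 1"
    using assms(1) spherical_finite_complex_compact by (auto simp: spherical_compact_manifold_def)
  then interpret warped_cone Y \<Gamma> a S using assms by (simp add: warped_cone_def)
  show ?thesis by (rule property_A_warped) fact
qed

end
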